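(* Let $k$ be a perfect field, let $A$ be a finite-dimensional semisimple associative $k$-algebra and let $M$ be a finite-dimensional $A$-bimodule. Let $A\rtimes_0 M$ be the trivial extension of $A$ by $M$. Then the canonical filtration of $A\rtimes_0 M$ is $$F(A\rtimes_0 M)^{\mathrm{Can}}_n=\begin{cases} A\rtimes_0 M & n\le 0,\\ M & n=1,\\ 0 & n>1.\end{cases}$$
   Context: The trivial extension $A\rtimes_0 M$ is the algebra which equals $A\oplus M$ as a vector space, with multiplication $(a,m)(a',m')=(aa',am'+ma')$; $M$ is identified with $0\oplus M$. An associative algebra $A$ (possibly non-unital) is semisimple if its Jacobson radical $J(A)$ is zero, where $J(A)=\{x\in A\mid \text{every element } z \text{ of } Ax \text{ is left quasi-regular, i.e. } y+z-yz=0 \text{ for some } y\in A\}$. A filtration $F_\bullet$ of a finite-dimensional associative algebra $B$ is a family of $k$-subspaces $F_m\subseteq B$, $m\in\mathbb{Z}$, such that $F_i\supseteq F_j$ when $i\le j$; $F_iF_j\subseteq F_{i+j}$ for all $i,j$; $F_i=B$ for $i\ll0$ and $F_i=0$ for $i\gg0$. The trivial filtration has $F_n=B$ for $n\le 0$ and $F_n=0$ for $n>0$. The weights of $F_\bullet$ are the integers $m$ with $F_m\ne F_{m+1}$. Set $$\mathrm{wt}(B,F_\bullet)=\sum_m m\dim(F_m/F_{m+1}),\quad \|F_\bullet\|=\Big(\sum_m m^2\dim(F_m/F_{m+1})\Big)^{1/2},\quad \nu(B,F_\bullet)=\frac{-\mathrm{wt}(B,F_\bullet)}{\|F_\bullet\|}$$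 ($\nu$ for non-trivial $F_\bullet$). $B$ is semistable if $-\mathrm{wt}(B,F_\bullet)\ge0$ for all filtrations, and unstable otherwise. The canonical filtration $F(B)^{\mathrm{Can}}_\bullet$ is the trivial filtration if $B$ is semistable, and if $B$ is unstable it is the filtration minimizing $\nu(B,-)$, which exists and is unique up to positive rescaling of the weights by a theorem of Kempf. Equalities describing canonical filtrations are understood up to positive rescaling of the weights. *)

theory Defs
  imports "HOL-Analysis.Product_Vector" "HOL-Computational_Algebra.Primes"
begin

definition perfect_field :: "'k::field itself \<Rightarrow> bool" where
  "perfect_field _ \<longleftrightarrow>
     CHAR('k) = 0 \<or> (\<forall>x::'k. \<exists>y::'k. y ^ CHAR('k) = x)"


section \<open>Finite-dimensional associative algebras, possibly without unit\<close>

locale fd_algebra = vector_space scale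
  for scale :: "'k::field \<Rightarrow> 'b::ab_group_add \<Rightarrow> 'b" (infixr \<open>*s\<close> 75) +
  fixes mult :: "'b \<Rightarrow> 'b \<Rightarrow> 'b" (infixl \<open>\<bullet>\<close> 70)
  assumes mult_assoc: "(x \<bullet> y) \<bullet> z = x \<bullet> (y \<bullet> z)"
    and mult_add_left: "(x + y) \<bullet> z = x \<bullet> z + y \<bullet> z"
    and mult_add_right: "x \<bullet> (y + z) = x \<bullet> y + x \<bullet> z"
    and mult_scale_left: "(c *s x) \<bullet> y = c *s (x \<bullet> y)"
    and mult_scale_right: "x \<bullet> (c *s y) = c *s (x \<bullet> y)"
    and finite_dim: "\<exists>S. finite S \<and> span S = UNIV"
begin

definition left_quasi_regular :: "'b \<Rightarrow> bool" where
  "left_quasi_regular z \<longleftrightarrow> (\<exists>y. y + z - y \<bullet> z = 0)"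

definition jacobson_radical :: "'b set" where
  "jacobson_radical = {x. \<forall>z \<in> range (\<lambda>a. a \<bullet> x). left_quasi_regular z}"

definition semisimple :: bool where
  "semisimple \<longleftrightarrow> jacobson_radical = {0}"


subsection \<open>Filtrations\<close>

text \<open>The condition \<open>F i F j \<subseteq> F (i + j)\<close> is stated on products of elements, which suffices
  because \<open>F (i + j)\<close> is a subspace.\<close>

definition filtration :: "(int \<Rightarrow> 'b set) \<Rightarrow> bool" where
  "filtration F \<longleftrightarrow>
     (\<forall>m. subspace (F m)) \<and>
     (\<forall>i j. i \<le> j \<longrightarrow> F j \<subseteq> F i) \<and>
     (\<forall>i j. \<forall>x \<in> F i. \<forall>y \<in> F j. x \<bullet> y \<in> F (i + j)) \<and>
     (\<exists>a. \<forall>i\<le>a. F i = UNIV) \<and>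
     (\<exists>b. \<forall>i\<ge>b. F i = {0})"

definition trivial_filtration :: "int \<Rightarrow> 'b set" where
  "trivial_filtration n = (if n \<le> 0 then UNIV else {0})"

definition weights :: "(int \<Rightarrow> 'b set) \<Rightarrow> int set" where
  "weights F = {m. F m \<noteq> F (m + 1)}"

text \<open>The dimension of the quotient space \<open>F m / F (m + 1)\<close>; the lemma \<open>dim_quotient\<close> below
  justifies the formula.\<close>

definition gr_dim :: "(int \<Rightarrow> 'b set) \<Rightarrow> int \<Rightarrow> int" where
  "gr_dim F m = int (dim (F m)) - int (dim (F (m + 1)))"

text \<open>The set of weights of a filtration is finite, and \<open>gr_dim F m\<close> vanishes at every other
  integer, so these are the sums over all integers.\<close>

definition wt :: "(int \<Rightarrow> 'b set) \<Rightarrow> int" where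
  "wt F = (\<Sum>m\<in>weights F. m * gr_dim F m)"

definition filtration_norm :: "(int \<Rightarrow> 'b set) \<Rightarrow> real" where
  "filtration_norm F = sqrt (real_of_int (\<Sum>m\<in>weights F. m\<^sup>2 * gr_dim F m))"

definition nu :: "(int \<Rightarrow> 'b set) \<Rightarrow> real" where
  "nu F = - real_of_int (wt F) / filtration_norm F"

definition semistable :: bool where
  "semistable \<longleftrightarrow> (\<forall>F. filtration F \<longrightarrow> - wt F \<ge> 0)"

text \<open>A canonical filtration is determined only up to positive rescaling of its weights, so it is
  a predicate; existence and uniqueness up to rescaling are not built in.\<close>

definition canonical_filtration :: "(int \<Rightarrow> 'b set) \<Rightarrow> bool" where
  "canonical_filtration F \<longleftrightarrow>
     (if semistable then F = trivial_filtration
      else filtration F \<and> F \<noteq> trivial_filtration \<and>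
        (\<forall>G. filtration G \<and> G \<noteq> trivial_filtration \<longrightarrow> nu F \<le> nu G))"

lemma dim_quotient:
  fixes q :: "'b \<Rightarrow> 'c::ab_group_add" and scale' :: "'k \<Rightarrow> 'c \<Rightarrow> 'c"
  assumes V: "subspace V" and W: "subspace W" and "W \<subseteq> V"
    and q: "Vector_Spaces.linear scale scale' q"
    and ker: "{x \<in> V. q x = 0} = W"
  shows "int (vector_space.dim scale' (q ` V)) = int (dim V) - int (dim W)"
proof -
  interpret q: Vector_Spaces.linear scale scale' q by fact
  obtain S where S: "finite S" "span S = UNIV" using finite_dim by blast
  obtain B where B: "B \<subseteq> W" "independent B" "W \<subseteq> span B" "card B = dim W"
    by (rule basis_exists)
  obtain C where C: "B \<subseteq> C" "C \<subseteq> V" "independent C" "V \<subseteq> span C"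
    using maximal_independent_subset_extend[of B V] B \<open>W \<subseteq> V\<close> by blast
  have finC: "finite C"
    using independent_span_bound[of S C] S C(3) by simp
  have dimV: "card C = dim V" using basis_card_eq_dim[of C V] C by simp
  have spC: "span C = V" using C span_minimal[OF C(2) V] by blast
  have spB: "span B = W" using B span_minimal[OF B(1) W] by blast
  let ?D = "C - B"
  have Dsub: "span ?D \<subseteq> V" using span_mono[of ?D C] spC by blast
  have indD: "independent ?D" using C(3) by (rule independent_mono) auto
  have inter: "x = 0" if x: "x \<in> span ?D" "x \<in> span B" for x
  proof -
    have "representation C x = representation ?D x" "representation C x = representation B x"
      using representation_extend[OF C(3) x(1)] representation_extend[OF C(3) x(2)] C(1) by auto
    then have "representation C x b = 0" for b
      using representation_ne_zero[of ?D x b] representation_ne_zero[of B x b] by force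
    moreover have "x \<in> span C" using x(1) Dsub spC by blast
    ultimately show "x = 0"
      using sum_nonzero_representation_eq[OF C(3), of x] by simp
  qed
  have inj: "inj_on q (span ?D)"
    by (subst q.inj_on_iff_eq_0[OF subspace_span]) (use inter ker Dsub spB in blast)
  have "\<not> q.vs2.dependent (q ` ?D)"
    by (rule q.independent_injective_image[OF indD inj])
  moreover have "q.vs2.span (q ` V) = q.vs2.span (q ` ?D)"
  proof -
    have "q ` V = q ` span C" using spC by simp
    also have "\<dots> = q.vs2.span (q ` C)" by (simp add: q.span_image)
    also have "q ` C \<subseteq> insert 0 (q ` ?D)" using B(1) ker by blast
    then have "q.vs2.span (q ` C) \<subseteq> q.vs2.span (q ` ?D)"
      using q.vs2.span_mono q.vs2.span_insert_0 by metis
    finally show ?thesis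
      using q.vs2.span_mono[of "q ` ?D" "q ` V"] C(2) q.vs2.span_minimal[of "q ` V" "q.vs2.span (q ` ?D)"]
      by (metis Diff_subset dual_order.trans image_mono q.vs2.subspace_span subset_antisym)
  qed
  ultimately have "q.vs2.dim (q ` V) = card (q ` ?D)"
    by (metis q.vs2.dim_eq_card)
  also have "\<dots> = card ?D"
    using inj span_superset by (intro card_image) (rule inj_on_subset)
  finally show ?thesis
    using dimV B(4) C(1) finC card_Diff_subset[of B C] card_mono[of C B] finite_subset[of B C] by simp
qed

end


subsection \<open>Rescaling\<close>

text \<open>Multiplies all weights by \<open>c > 0\<close>: the integer \<open>n\<close> is a weight of \<open>rescale c F\<close> iff
  \<open>n = c m\<close> for a weight \<open>m\<close> of \<open>F\<close>.\<close>

definition rescale :: "int \<Rightarrow> (int \<Rightarrow> 'b set) \<Rightarrow> int \<Rightarrow> 'b set" where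
  "rescale c F n = F \<lceil>real_of_int n / real_of_int c\<rceil>"

text \<open>\<open>G\<close> is obtained from \<open>F\<close> by multiplying the weights by the positive rational \<open>p / q\<close>.\<close>

definition rescaling_equivalent :: "(int \<Rightarrow> 'b set) \<Rightarrow> (int \<Rightarrow> 'b set) \<Rightarrow> bool" where
  "rescaling_equivalent F G \<longleftrightarrow> (\<exists>p q. p > 0 \<and> q > 0 \<and> rescale p F = rescale q G)"


section \<open>Bimodules and trivial extensions\<close>

text \<open>Bimodules are not assumed to be unital, since the algebra need not have a unit.\<close>

locale fd_bimodule = A: fd_algebra scaleA multA + M: vector_space scaleM
  for scaleA :: "'k::field \<Rightarrow> 'a::ab_group_add \<Rightarrow> 'a" (infixr \<open>*a\<close> 75)
    and multA :: "'a \<Rightarrow> 'a \<Rightarrow> 'a" (infixl \<open>\<bullet>\<close> 70)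
    and scaleM :: "'k \<Rightarrow> 'm::ab_group_add \<Rightarrow> 'm" (infixr \<open>*m\<close> 75) +
  fixes lact :: "'a \<Rightarrow> 'm \<Rightarrow> 'm" (infixr \<open>\<rhd>\<close> 70)
    and ract :: "'m \<Rightarrow> 'a \<Rightarrow> 'm" (infixl \<open>\<lhd>\<close> 70)
  assumes lact_assoc: "(a \<bullet> b) \<rhd> m = a \<rhd> (b \<rhd> m)"
    and ract_assoc: "m \<lhd> (a \<bullet> b) = (m \<lhd> a) \<lhd> b"
    and lact_ract: "(a \<rhd> m) \<lhd> b = a \<rhd> (m \<lhd> b)"
    and lact_add_left: "(a + b) \<rhd> m = (a \<rhd> m) + (b \<rhd> m)"
    and lact_add_right: "a \<rhd> (m + n) = (a \<rhd> m) + (a \<rhd> n)"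
    and lact_scale_left: "(c *a a) \<rhd> m = c *m (a \<rhd> m)"
    and lact_scale_right: "a \<rhd> (c *m m) = c *m (a \<rhd> m)"
    and ract_add_left: "(m + n) \<lhd> a = (m \<lhd> a) + (n \<lhd> a)"
    and ract_add_right: "m \<lhd> (a + b) = (m \<lhd> a) + (m \<lhd> b)"
    and ract_scale_left: "(c *m m) \<lhd> a = c *m (m \<lhd> a)"
    and ract_scale_right: "m \<lhd> (c *a a) = c *m (m \<lhd> a)"
    and finite_dim_M: "\<exists>S. finite S \<and> M.span S = UNIV"

definition trivial_ext_mult ::
    "('a \<Rightarrow> 'a \<Rightarrow> 'a) \<Rightarrow> ('a \<Rightarrow> 'm \<Rightarrow> 'm) \<Rightarrow> ('m \<Rightarrow> 'a \<Rightarrow> 'm) \<Rightarrow>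
      'a \<times> 'm \<Rightarrow> 'a \<times> 'm \<Rightarrow> 'a \<times> 'm::ab_group_add" where
  "trivial_ext_mult multA lact ract =
     (\<lambda>(a, m) (a', m'). (multA a a', lact a m' + ract m a'))"

text \<open>The filtration \<open>A \<rtimes> M\<close>, \<open>M\<close>, \<open>0\<close> in degrees \<open>n \<le> 0\<close>, \<open>n = 1\<close>, \<open>n > 1\<close>.\<close>

definition trivial_ext_filtration :: "int \<Rightarrow> ('a::ab_group_add \<times> 'm::ab_group_add) set" where
  "trivial_ext_filtration n = (if n \<le> 0 then UNIV else if n = 1 then {0} \<times> UNIV else {0})"

context fd_bimodule
begin

sublocale AM: vector_space_prod scaleA scaleM
  by unfold_locales

sublocale ext: fd_algebra AM.scale "trivial_ext_mult multA lact ract"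
proof
  obtain S T where S: "finite S" "A.span S = UNIV" and T: "finite T" "M.span T = UNIV"
    using A.finite_dim finite_dim_M by blast
  let ?U = "(\<lambda>a. (a, 0)) ` S \<union> Pair 0 ` T"
  have 1: "(a, 0) \<in> AM.p.span ?U" for a
  proof -
    have "a \<in> A.span S" using S by simp
    then show ?thesis
    proof (induction rule: A.span_induct_alt)
      case base
      then show ?case using AM.p.span_zero by (simp add: zero_prod_def)
    next
      case (step c x y)
      have "(c *a x + y, 0) = AM.scale c (x, 0) + (y, 0)" by (simp add: AM.scale_prod)
      with step show ?case
        by (auto intro!: AM.p.span_add AM.p.span_scale intro: AM.p.span_base)
    qed
  qed
  have 2: "(0, m) \<in> AM.p.span ?U" for m
  proof -
    have "m \<in> M.span T" using T by simp
    then show ?thesis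
    proof (induction rule: M.span_induct_alt)
      case base
      then show ?case using AM.p.span_zero by (simp add: zero_prod_def)
    next
      case (step c x y)
      have "(0, c *m x + y) = AM.scale c (0, x) + (0, y)" by (simp add: AM.scale_prod)
      with step show ?case
        by (auto intro!: AM.p.span_add AM.p.span_scale intro: AM.p.span_base)
    qed
  qed
  have "(a, m) \<in> AM.p.span ?U" for a m
    using AM.p.span_add[OF 1[of a] 2[of m]] by simp
  then show "\<exists>S. finite S \<and> AM.p.span S = UNIV"
    using S(1) T(1) by (intro exI[of _ ?U]) auto
qed (auto simp: trivial_ext_mult_def AM.scale_def split_beta algebra_simps
    A.mult_assoc A.mult_add_left A.mult_add_right A.mult_scale_left A.mult_scale_right
    lact_assoc ract_assoc lact_ract lact_add_left lact_add_right lact_scale_left lact_scale_right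
    ract_add_left ract_add_right ract_scale_left ract_scale_right
    M.scale_right_distrib)

end

end

theory Submission
  imports Defs
begin

text \<open>Let \<open>F\<close> be a filtration of the trivial extension \<open>B\<close> of \<open>A\<close> by \<open>M\<close>, and let \<open>d = dim M\<close>. It
  induces filtrations of the ideal \<open>M\<close> and of the quotient \<open>A\<close>, and both the weight and the second
  moment \<open>\<Sum> m\<^sup>2 dim (F m / F (m + 1))\<close> of \<open>F\<close> are the sums of the two induced ones. The algebra \<open>A\<close> is
  semistable, so it contributes a nonpositive weight, and on \<open>M\<close> the Cauchy--Schwarz inequality
  bounds the weight by \<open>\<surd> d\<close> times the norm. Hence \<open>\<nu> \<ge> - \<surd> d\<close> on \<open>B\<close>, which is the value at the
  filtration with \<open>A\<close> in weight \<open>0\<close> and \<open>M\<close> in weight \<open>1\<close>. If \<open>\<nu> = - \<surd> d < 0\<close>, then both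
  estimates are sharp: \<open>A\<close> has second moment zero, so that its induced filtration is trivial, and \<open>M\<close>
  has a single weight, which is positive. Such a filtration is a rescaling of the given one
  (\<open>extremal_filtration_stretched\<close>). If \<open>M = 0\<close>, the same estimate says that \<open>B\<close> is semistable.

  The semistability of \<open>A\<close> (\<open>semiprime_wt_nonpos\<close>) comes from a linear functional \<open>t\<close> that vanishes on
  \<open>F 1\<close> and for which the form \<open>(x, y) \<mapsto> t (x \<bullet> y)\<close> is nondegenerate. Since \<open>F i F (1 - i) \<subseteq> F 1\<close>, the
  subspaces \<open>F i\<close> and \<open>F (1 - i)\<close> are orthogonal, so \<open>dim F i + dim F (1 - i) \<le> dim A\<close>, and summation
  by parts turns these inequalities into \<open>wt F \<le> 0\<close>. For a matrix algebra over a division algebra one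
  may think of \<open>F 1\<close> as strictly upper triangular and of \<open>t\<close> as the trace followed by a functional of
  the division algebra. In \<open>corner_functional\<close> the diagonal is produced by splitting off idempotents
  one at a time; semisimplicity enters through the implication from \<open>x A x = 0\<close> to \<open>x = 0\<close>.\<close>


section \<open>Idempotents in semiprime algebras\<close>

context fd_algebra
begin

lemma obtain_basis:
  obtains B where "finite_dimensional_vector_space scale B"
proof -
  obtain S where S: "finite S" "span S = UNIV" using finite_dim by blast
  obtain B where B: "B \<subseteq> UNIV" "independent B" "UNIV \<subseteq> span B"
    using maximal_independent_subset by metis
  have "finite B" using independent_span_bound[OF S(1) B(2)] S(2) by simp
  with B have "finite_dimensional_vector_space scale B"
    by unfold_locales auto
  then show thesis by (rule that)
qed

lemma dim_mono: "S \<subseteq> T \<Longrightarrow> dim S \<le> dim T"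
proof -
  obtain B where "finite_dimensional_vector_space scale B" by (rule obtain_basis)
  then interpret fin: finite_dimensional_vector_space scale B .
  show "S \<subseteq> T \<Longrightarrow> dim S \<le> dim T" by (rule fin.dim_subset)
qed

lemma subspace_eqI_dim: "subspace S \<Longrightarrow> subspace T \<Longrightarrow> S \<subseteq> T \<Longrightarrow> dim T \<le> dim S \<Longrightarrow> S = T"
proof -
  obtain B where "finite_dimensional_vector_space scale B" by (rule obtain_basis)
  then interpret fin: finite_dimensional_vector_space scale B .
  show "subspace S \<Longrightarrow> subspace T \<Longrightarrow> S \<subseteq> T \<Longrightarrow> dim T \<le> dim S \<Longrightarrow> S = T"
    by (rule fin.subspace_dim_equal)
qed

lemma dim_less: "subspace S \<Longrightarrow> subspace T \<Longrightarrow> S \<subset> T \<Longrightarrow> dim S < dim T"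
  using subspace_eqI_dim[of S T] by force

lemma dim_zero [simp]: "dim {0} = 0"
  using dim_le_card[of "{0}" "{}"] by simp

lemma mult_zero_right: "x \<bullet> 0 = 0"
  using mult_add_right[of x 0 0] by simp

lemma mult_zero_left: "0 \<bullet> x = 0"
  using mult_add_left[of 0 0 x] by simp

lemma mult_minus_right: "x \<bullet> (- y) = - (x \<bullet> y)"
  using mult_add_right[of x y "- y"] by (simp add: eq_neg_iff_add_eq_0 add.commute mult_zero_right)

lemma mult_minus_left: "(- x) \<bullet> y = - (x \<bullet> y)"
  using mult_add_left[of x "- x" y] by (simp add: eq_neg_iff_add_eq_0 add.commute mult_zero_left)

lemma mult_diff_right: "x \<bullet> (y - z) = x \<bullet> y - x \<bullet> z"
  using mult_add_right[of x y "- z"] by (simp add: mult_minus_right)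

lemma mult_diff_left: "(x - y) \<bullet> z = x \<bullet> z - y \<bullet> z"
  using mult_add_left[of x "- y" z] by (simp add: mult_minus_left)

lemmas mult_distribs = mult_add_left mult_add_right mult_diff_left mult_diff_right
  mult_zero_left mult_zero_right

definition semiprime :: bool where
  "semiprime \<longleftrightarrow> (\<forall>x. (\<forall>a. x \<bullet> a \<bullet> x = 0) \<longrightarrow> x = 0)"

lemma semiprimeD: "semiprime \<Longrightarrow> (\<And>a. x \<bullet> a \<bullet> x = 0) \<Longrightarrow> x = 0"
  unfolding semiprime_def by blast

text \<open>If \<open>x A x = 0\<close>, then every element of \<open>A x\<close> squares to zero, and \<open>z\<^sup>2 = 0\<close>
  makes \<open>- z\<close> a left quasi-inverse of \<open>z\<close>; hence \<open>x\<close> lies in the radical.\<close>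

lemma semisimple_imp_semiprime:
  assumes semisimple
  shows semiprime
  unfolding semiprime_def
proof (intro allI impI)
  fix x assume x: "\<forall>a. x \<bullet> a \<bullet> x = 0"
  have "left_quasi_regular (a \<bullet> x)" for a
    unfolding left_quasi_regular_def
  proof
    have "(a \<bullet> x) \<bullet> (a \<bullet> x) = a \<bullet> (x \<bullet> a \<bullet> x)" by (simp add: mult_assoc)
    then show "- (a \<bullet> x) + a \<bullet> x - (- (a \<bullet> x)) \<bullet> (a \<bullet> x) = 0"
      using x by (simp add: mult_minus_left mult_zero_right)
  qed
  then have "x \<in> jacobson_radical" by (auto simp: jacobson_radical_def)
  with assms show "x = 0" by (simp add: semisimple_def)
qed

definition right_ideal :: "'b set \<Rightarrow> bool" where
  "right_ideal R \<longleftrightarrow> subspace R \<and> (\<forall>x\<in>R. \<forall>a. x \<bullet> a \<in> R)"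

lemma subspace_mult_image:
  assumes "subspace R" shows "subspace ((\<bullet>) a ` R)"
proof (rule subspaceI)
  show "0 \<in> (\<bullet>) a ` R" using subspace_0[OF assms] by (auto intro!: image_eqI[of _ _ 0] simp: mult_zero_right)
next
  fix x y assume "x \<in> (\<bullet>) a ` R" "y \<in> (\<bullet>) a ` R"
  then show "x + y \<in> (\<bullet>) a ` R"
    using subspace_add[OF assms] by (auto simp: mult_add_right[symmetric])
next
  fix c x assume "x \<in> (\<bullet>) a ` R"
  then show "c *s x \<in> (\<bullet>) a ` R"
    using subspace_scale[OF assms] by (auto simp: mult_scale_right[symmetric])
qed

text \<open>Brauer's lemma. In a minimal right ideal \<open>S\<close> inside \<open>R\<close> some \<open>a\<close> has \<open>a S \<noteq> 0\<close>, since
  otherwise \<open>x A x \<subseteq> S S = 0\<close> for \<open>x \<in> S\<close>. By minimality left multiplication by \<open>a\<close> is then a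
  bijection of \<open>S\<close>, and the \<open>f \<in> S\<close> with \<open>a \<bullet> f = a\<close> is idempotent because \<open>a \<bullet> (f \<bullet> f) = a \<bullet> f\<close>.\<close>

lemma right_ideal_contains_idempotent:
  assumes semiprime and R: "right_ideal R" and x: "x \<in> R" "x \<noteq> 0"
  obtains f where "f \<in> R" "f \<bullet> f = f" "f \<noteq> 0"
proof -
  let ?P = "\<lambda>S. right_ideal S \<and> S \<subseteq> R \<and> S \<noteq> {0}"
  have "?P R" using R x by auto
  then obtain S where S: "?P S" and min: "\<And>T. ?P T \<Longrightarrow> dim S \<le> dim T"
    using ex_has_least_nat[of ?P R dim] by blast
  have sub: "subspace S" and mul: "\<And>x a. x \<in> S \<Longrightarrow> x \<bullet> a \<in> S"
    using S by (auto simp: right_ideal_def)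
  have minS: "T = S" if "right_ideal T" "T \<subseteq> S" "T \<noteq> {0}" for T
    using that S min[of T] sub subspace_eqI_dim[of T S] by (auto simp: right_ideal_def)
  have "\<exists>a\<in>S. \<exists>y\<in>S. a \<bullet> y \<noteq> 0"
  proof (rule ccontr)
    assume none: "\<not> ?thesis"
    have "y = 0" if "y \<in> S" for y
    proof (rule semiprimeD[OF \<open>semiprime\<close>])
      show "y \<bullet> a \<bullet> y = 0" for a using none that mul[OF that] by blast
    qed
    with S subspace_0[OF sub] show False by blast
  qed
  then obtain a y where a: "a \<in> S" "y \<in> S" "a \<bullet> y \<noteq> 0" by blast
  have "(\<bullet>) a ` S = S"
  proof (rule minS)
    show "right_ideal ((\<bullet>) a ` S)"
      unfolding right_ideal_def
      using subspace_mult_image[OF sub] mul by (auto simp: mult_assoc)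
    show "(\<bullet>) a ` S \<subseteq> S" using a mul by blast
    show "(\<bullet>) a ` S \<noteq> {0}" using a by blast
  qed
  then obtain f where f: "f \<in> S" "a \<bullet> f = a" using a(1) by (metis imageE)
  let ?T = "{z \<in> S. a \<bullet> z = 0}"
  have "right_ideal ?T"
    unfolding right_ideal_def using mul subspace_0[OF sub] subspace_add[OF sub] subspace_scale[OF sub]
    by (auto intro!: subspaceI simp: mult_distribs mult_scale_right mult_assoc[symmetric])
  moreover have "?T \<noteq> S" using a by blast
  ultimately have T0: "?T = {0}" using minS[of ?T] by blast
  have "f \<bullet> f - f \<in> ?T"
    using f mul[of f f] subspace_diff[OF sub] by (simp add: mult_diff_right mult_assoc[symmetric])
  then have "f \<bullet> f = f" using T0 by auto
  moreover have "f \<noteq> 0" using f a by (auto simp: mult_zero_left mult_zero_right)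
  moreover have "f \<in> R" using f S by blast
  ultimately show thesis by (intro that)
qed

text \<open>Take an idempotent \<open>e\<close> whose right annihilator has least dimension. An idempotent \<open>f\<close> in
  that annihilator would make the annihilator of \<open>e + f - f \<bullet> e\<close> strictly smaller, so it is zero and
  \<open>e\<close> is a left unit. Then \<open>x - x \<bullet> e\<close> annihilates everything on its right and vanishes too.\<close>

lemma semiprime_unit:
  assumes semiprime
  obtains e where "\<And>x. e \<bullet> x = x" "\<And>x. x \<bullet> e = x"
proof -
  let ?ann = "\<lambda>e. {x. e \<bullet> x = 0}"
  have ann: "right_ideal (?ann e)" for e
    unfolding right_ideal_def
    by (auto intro!: subspaceI simp: mult_distribs mult_scale_right mult_assoc[symmetric])
  have "0 \<bullet> 0 = 0" by (rule mult_zero_left)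
  then obtain e where e: "e \<bullet> e = e"
    and min: "\<And>e'. e' \<bullet> e' = e' \<Longrightarrow> dim (?ann e) \<le> dim (?ann e')"
    using ex_has_least_nat[of "\<lambda>e. e \<bullet> e = e" 0 "\<lambda>e. dim (?ann e)"] by blast
  have ann0: "?ann e \<subseteq> {0}"
  proof (rule ccontr)
    assume "\<not> ?thesis"
    then obtain x where "x \<in> ?ann e" "x \<noteq> 0" by blast
    from right_ideal_contains_idempotent[OF assms ann this]
    obtain f where f: "e \<bullet> f = 0" "f \<bullet> f = f" "f \<noteq> 0" by blast
    have fef: "f \<bullet> (e \<bullet> x) = f \<bullet> e \<bullet> x" "e \<bullet> (f \<bullet> x) = 0" "f \<bullet> (f \<bullet> x) = f \<bullet> x"
      "e \<bullet> (e \<bullet> x) = e \<bullet> x" for x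
      using f e by (simp_all add: mult_assoc[symmetric] mult_zero_left)
    let ?e = "e + f - f \<bullet> e"
    have idem: "?e \<bullet> ?e = ?e" and eq: "e \<bullet> ?e = e" and ef: "?e \<bullet> f = f"
      using f e fef by (simp_all add: mult_distribs mult_assoc)
    have "?ann ?e \<subseteq> ?ann e"
    proof
      fix x assume "x \<in> ?ann ?e"
      then have "e \<bullet> (?e \<bullet> x) = 0" by (simp add: mult_zero_right)
      then show "x \<in> ?ann e" by (simp add: mult_assoc[symmetric] eq)
    qed
    moreover have "f \<in> ?ann e" "f \<notin> ?ann ?e" using f ef by auto
    ultimately have "?ann ?e \<subset> ?ann e" by blast
    then have "dim (?ann ?e) < dim (?ann e)"
      using ann[of ?e] ann[of e] by (intro dim_less) (auto simp: right_ideal_def)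
    with min[OF idem] show False by simp
  qed
  have left: "e \<bullet> x = x" for x
  proof -
    have "e \<bullet> x - x \<in> ?ann e" by (simp add: mult_diff_right mult_assoc[symmetric] e)
    then show ?thesis using ann0 by auto
  qed
  have right: "x \<bullet> e = x" for x
  proof -
    have "(x - x \<bullet> e) \<bullet> a = 0" for a by (simp add: mult_diff_left mult_assoc left)
    then have "(x - x \<bullet> e) \<bullet> a \<bullet> (x - x \<bullet> e) = 0" for a by (simp add: mult_zero_left)
    then have "x - x \<bullet> e = 0" by (rule semiprimeD[OF assms])
    then show ?thesis by simp
  qed
  from left right show thesis by (rule that)
qed


section \<open>Nondegenerate functionals adapted to a filtration\<close>

definition corner :: "'b \<Rightarrow> 'b set" where
  "corner e = {x. e \<bullet> x = x \<and> x \<bullet> e = x}"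

lemma subspace_corner: "subspace (corner e)"
  unfolding corner_def
  by (rule subspaceI) (auto simp: mult_distribs mult_scale_left mult_scale_right)

lemma corner_psubset:
  assumes e: "e \<bullet> e = e" and f: "f \<in> corner e" "f \<noteq> e"
  shows "corner f \<subset> corner e"
proof -
  have ef: "e \<bullet> f = f" "f \<bullet> e = f" using f by (auto simp: corner_def)
  have "x \<in> corner e" if "x \<in> corner f" for x
  proof -
    have x: "f \<bullet> x = x" "x \<bullet> f = x" using that by (auto simp: corner_def)
    have "e \<bullet> x = e \<bullet> f \<bullet> x" "x \<bullet> e = x \<bullet> (f \<bullet> e)"
      using x by (simp add: mult_assoc) (simp add: mult_assoc[symmetric] x)
    then show ?thesis using x ef by (simp add: corner_def)
  qed
  moreover have "e \<in> corner e" "e \<notin> corner f" using e ef f by (auto simp: corner_def)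
  ultimately show ?thesis by blast
qed

lemma filtrationD:
  assumes "filtration F"
  shows filtration_subspace: "subspace (F m)"
    and filtration_antimono: "i \<le> j \<Longrightarrow> F j \<subseteq> F i"
    and filtration_mult: "x \<in> F i \<Longrightarrow> y \<in> F j \<Longrightarrow> x \<bullet> y \<in> F (i + j)"
    and filtration_top: "\<exists>a. \<forall>i\<le>a. F i = UNIV"
    and filtration_bot: "\<exists>b. \<forall>i\<ge>b. F i = {0}"
  using assms unfolding filtration_def by blast+

lemma filtration_trivial: "filtration trivial_filtration"
  unfolding filtration_def
proof (intro conjI allI ballI impI)
  show "\<exists>a. \<forall>i\<le>a. trivial_filtration i = (UNIV :: 'b set)"
    by (intro exI[of _ 0]) (auto simp: trivial_filtration_def)
  show "\<exists>b. \<forall>i\<ge>b. trivial_filtration i = ({0} :: 'b set)"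
    by (intro exI[of _ 1]) (auto simp: trivial_filtration_def)
qed (auto simp: trivial_filtration_def mult_distribs split: if_splits)

text \<open>The last nonzero \<open>e \<bullet> F k \<bullet> e\<close> with \<open>k > 0\<close> is killed by \<open>e \<bullet> F 1\<close>, because compression by
  \<open>e\<close> is multiplicative on \<open>F 1\<close>. So the elements of \<open>e A\<close> killed in this way form a nonzero right
  ideal, and an idempotent \<open>f\<close> of this ideal gives the idempotent \<open>f \<bullet> e\<close> of the corner. It differs
  from \<open>e\<close> because \<open>e \<bullet> F 1 \<bullet> e = e \<bullet> F 1\<close> is not zero.\<close>

lemma idempotent_killed_by_positive_part:
  assumes semiprime and F: "filtration F" and e: "e \<bullet> e = e"
    and tri: "\<And>n. n \<in> F 1 \<Longrightarrow> e \<bullet> n \<bullet> e = e \<bullet> n"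
    and ne: "n \<in> F 1" "e \<bullet> n \<noteq> 0"
  obtains f where "f \<in> corner e" "f \<bullet> f = f" "f \<noteq> 0" "f \<noteq> e" "\<And>n. n \<in> F 1 \<Longrightarrow> e \<bullet> n \<bullet> f = 0"
proof -
  let ?Q = "\<lambda>k::nat. \<exists>z \<in> F (1 + int k). e \<bullet> z \<bullet> e \<noteq> 0"
  obtain b where b: "\<And>i. i \<ge> b \<Longrightarrow> F i = {0}" using filtration_bot[OF F] by blast
  have bound: "k \<le> nat b" if "?Q k" for k
  proof (rule ccontr)
    assume "\<not> k \<le> nat b"
    then have "F (1 + int k) = {0}" by (intro b) linarith
    with that show False by (simp add: mult_distribs)
  qed
  have "?Q 0" using ne tri[of n] by force
  then obtain k where k: "?Q k" and max: "\<And>j. ?Q j \<Longrightarrow> j \<le> k"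
    using ex_has_greatest_nat[of ?Q 0 "\<lambda>k. k" "Suc (nat b)"] bound by (metis le_imp_less_Suc)
  obtain z where z: "z \<in> F (1 + int k)" "e \<bullet> z \<bullet> e \<noteq> 0" using k by blast
  define R where "R = {x. e \<bullet> x = x \<and> (\<forall>n \<in> F 1. e \<bullet> n \<bullet> x = 0)}"
  have R: "right_ideal R"
    unfolding right_ideal_def
  proof
    show "subspace R"
      by (rule subspaceI) (auto simp: R_def mult_distribs mult_scale_right)
    show "\<forall>x\<in>R. \<forall>a. x \<bullet> a \<in> R" by (auto simp: R_def mult_assoc[symmetric] mult_zero_left)
  qed
  have "e \<bullet> n \<bullet> (e \<bullet> z \<bullet> e) = 0" if n: "n \<in> F 1" for n
  proof -
    have "e \<bullet> n \<bullet> (e \<bullet> z \<bullet> e) = (e \<bullet> n \<bullet> e) \<bullet> (z \<bullet> e)" by (simp add: mult_assoc)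
    also have "\<dots> = e \<bullet> (n \<bullet> z) \<bullet> e" using tri[OF n] by (simp add: mult_assoc)
    also have "\<dots> = 0"
    proof (rule ccontr)
      assume "\<not> ?thesis"
      moreover have "n \<bullet> z \<in> F (1 + int (Suc k))"
        using filtration_mult[OF F n z(1)] by (simp add: algebra_simps)
      ultimately have "?Q (Suc k)" by blast
      from max[OF this] show False by simp
    qed
    finally show ?thesis .
  qed
  then have "e \<bullet> z \<bullet> e \<in> R" by (simp add: R_def mult_assoc[symmetric] e)
  from right_ideal_contains_idempotent[OF \<open>semiprime\<close> R this z(2)]
  obtain f where f: "f \<in> R" "f \<bullet> f = f" "f \<noteq> 0" by blast
  have ef: "e \<bullet> f = f" and kill: "\<And>n. n \<in> F 1 \<Longrightarrow> e \<bullet> n \<bullet> f = 0"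
    using f by (auto simp: R_def)
  have ef': "e \<bullet> (f \<bullet> x) = f \<bullet> x" and ff': "f \<bullet> (f \<bullet> x) = f \<bullet> x" for x
    using ef f(2) by (simp_all add: mult_assoc[symmetric])
  have fef: "(f \<bullet> e) \<bullet> f = f" by (simp add: mult_assoc ef f(2))
  have kill': "e \<bullet> n \<bullet> (f \<bullet> e) = 0" if "n \<in> F 1" for n
    using kill[OF that] by (simp add: mult_assoc[symmetric] mult_zero_left)
  show thesis
  proof
    show "f \<bullet> e \<in> corner e" by (simp add: corner_def ef' mult_assoc e)
    show "f \<bullet> e \<bullet> (f \<bullet> e) = f \<bullet> e" by (simp add: mult_assoc ef' ff')
    show "f \<bullet> e \<noteq> 0" using fef f(3) by (auto simp: mult_distribs)
    show "f \<bullet> e \<noteq> e"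
      using kill'[OF ne(1)] tri[OF ne(1)] ne(2) by auto
  qed (rule kill')
qed

lemma obtain_functional:
  assumes "x \<noteq> 0"
  obtains t where "Vector_Spaces.linear scale (*) t" "t x \<noteq> (0::'k)"
proof -
  have "independent {x}" using assms by (simp add: dependent_single)
  then obtain B where B: "{x} \<subseteq> B" "B \<subseteq> UNIV" "independent B" "UNIV \<subseteq> span B"
    by (rule maximal_independent_subset_extend[OF subset_UNIV])
  have "Vector_Spaces.linear scale (*) (\<lambda>v. representation B v x)"
    using B by (intro linear_representation) auto
  moreover have "representation B x x = 1"
    using representation_basis[OF B(3), of x] B(1) by simp
  ultimately show thesis by (simp add: that)
qed

lemma corner_without_idempotents_inverse:
  assumes semiprime and e: "e \<bullet> e = e"
    and noidem: "\<And>f. f \<in> corner e \<Longrightarrow> f \<bullet> f = f \<Longrightarrow> f = 0 \<or> f = e"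
    and x: "x \<in> corner e" "x \<noteq> 0"
  obtains y where "y \<in> corner e" "y \<bullet> x = e"
proof -
  have rinv: "\<exists>y \<in> corner e. x \<bullet> y = e" if x: "x \<in> corner e" "x \<noteq> 0" for x
  proof -
    have ex: "e \<bullet> x = x" "x \<bullet> e = x" using x by (auto simp: corner_def)
    have "right_ideal (range ((\<bullet>) x))"
      unfolding right_ideal_def using subspace_mult_image[OF subspace_UNIV] by (auto simp: mult_assoc)
    moreover have "x \<in> range ((\<bullet>) x)" using ex(2) by (metis rangeI)
    ultimately obtain f where f: "f \<in> range ((\<bullet>) x)" "f \<bullet> f = f" "f \<noteq> 0"
      using right_ideal_contains_idempotent[OF \<open>semiprime\<close>] x(2) by blast
    then obtain b where b: "f = x \<bullet> b" by blast
    have ef: "e \<bullet> f = f" by (simp add: b mult_assoc[symmetric] ex)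
    have "f \<bullet> e \<in> corner e" by (simp add: corner_def mult_assoc e) (simp add: mult_assoc[symmetric] ef)
    moreover have "f \<bullet> e \<bullet> (f \<bullet> e) = f \<bullet> e"
      by (simp add: mult_assoc) (simp add: mult_assoc[symmetric] ef f)
    moreover have "f \<bullet> e \<bullet> f = f" by (simp add: mult_assoc ef f)
    then have "f \<bullet> e \<noteq> 0" using f(3) by (auto simp: mult_distribs)
    ultimately have fe: "f \<bullet> e = e" using noidem by blast
    have "x \<bullet> (e \<bullet> b \<bullet> e) = (x \<bullet> e) \<bullet> b \<bullet> e" by (simp add: mult_assoc)
    also have "\<dots> = e" using fe by (simp add: ex b)
    finally have "x \<bullet> (e \<bullet> b \<bullet> e) = e" .
    moreover have "e \<bullet> b \<bullet> e \<in> corner e"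
      by (simp add: corner_def mult_assoc e) (simp add: mult_assoc[symmetric] e)
    ultimately show ?thesis by blast
  qed
  obtain y where y: "y \<in> corner e" "x \<bullet> y = e" using rinv[OF x] by blast
  have ex: "e \<bullet> x = x" "x \<bullet> e = x" using x by (auto simp: corner_def)
  have "y \<noteq> 0" using y(2) x ex by (auto simp: mult_distribs)
  then obtain z where z: "z \<in> corner e" "y \<bullet> z = e" using rinv[OF y(1)] by blast
  have "x = x \<bullet> (y \<bullet> z)" by (simp add: z ex)
  also have "\<dots> = z" using z(1) by (simp add: mult_assoc[symmetric] y) (simp add: corner_def)
  finally have "y \<bullet> x = e" using z by simp
  with y show thesis by (intro that)
qed

text \<open>An idempotent \<open>f\<close> of the corner with \<open>e \<bullet> F 1 \<bullet> f = 0\<close> makes \<open>F 1\<close> block triangular with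
  respect to \<open>e = f + g\<close>, with zero block at \<open>f\<close>, and functionals on the two diagonal blocks add up
  to one on the whole corner. If \<open>x\<close> lies in the kernel of the resulting form and \<open>h \<in> {f, g}\<close>, then
  the functional of the block at \<open>h\<close> vanishes on \<open>h A (h \<bullet> b \<bullet> x \<bullet> h)\<close> for every \<open>b\<close>, so that
  \<open>h \<bullet> b \<bullet> x \<bullet> h = 0\<close>. Hence \<open>(x \<bullet> h) A (x \<bullet> h) = 0\<close> and \<open>x \<bullet> h = 0\<close>. The splitting stops at a corner
  that is zero or a division algebra; on the latter every nonzero functional is nondegenerate.

  The hypothesis \<open>e \<bullet> n \<bullet> e = e \<bullet> n\<close> makes compression by \<open>e\<close> multiplicative on \<open>F 1\<close> and passes to
  \<open>g\<close>. It may fail at \<open>f\<close>, but there \<open>F 1\<close> has zero block, so the trivial filtration serves.\<close>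

lemma corner_functional:
  assumes "semiprime" and "filtration F" and "e \<bullet> e = e"
    and "\<And>n. n \<in> F 1 \<Longrightarrow> e \<bullet> n \<bullet> e = e \<bullet> n"
  shows "\<exists>t. Vector_Spaces.linear scale (*) t \<and> (\<forall>n \<in> F 1. t (e \<bullet> n \<bullet> e) = (0::'k)) \<and>
    (\<forall>x \<in> corner e. (\<forall>a. t (e \<bullet> a \<bullet> x) = 0) \<longrightarrow> x = 0)"
  using assms(2-)
proof (induction "dim (corner e)" arbitrary: e F rule: less_induct)
  case less
  note F = less.prems(1) and e = less.prems(2) and tri = less.prems(3)
  interpret vs: vector_space_pair scale "(*) :: 'k \<Rightarrow> 'k \<Rightarrow> 'k"
    by unfold_locales (auto simp: algebra_simps)
  have dims: "dim (corner f) < dim (corner e)" if "f \<in> corner e" "f \<noteq> e" for f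
    using corner_psubset[OF e that] by (intro dim_less subspace_corner)
  show ?case
  proof (cases "\<exists>f \<in> corner e. f \<bullet> f = f \<and> f \<noteq> 0 \<and> f \<noteq> e \<and> (\<forall>n \<in> F 1. e \<bullet> n \<bullet> f = 0)")
    case True
    then obtain f where f: "f \<in> corner e" "f \<bullet> f = f" "f \<noteq> 0" "f \<noteq> e"
      and kill: "\<And>n. n \<in> F 1 \<Longrightarrow> e \<bullet> n \<bullet> f = 0" by blast
    define g where "g = e - f"
    have ef: "e \<bullet> f = f" "f \<bullet> e = f" using f by (auto simp: corner_def)
    have g: "g \<in> corner e" "g \<bullet> g = g" "g \<noteq> e" and fg: "f \<bullet> g = 0" "g \<bullet> f = 0"
      and eg: "e \<bullet> g = g" "g \<bullet> e = g"
      using f e ef by (auto simp: g_def corner_def mult_distribs)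
    have "g \<bullet> n \<bullet> g = g \<bullet> n" if n: "n \<in> F 1" for n
    proof -
      have "g \<bullet> n \<bullet> f = g \<bullet> (e \<bullet> n \<bullet> f)" by (simp add: mult_assoc[symmetric] eg)
      then have gnf: "g \<bullet> n \<bullet> f = 0" using kill[OF n] by (simp add: mult_distribs)
      have "g \<bullet> n \<bullet> e = g \<bullet> (e \<bullet> n \<bullet> e)" by (simp add: mult_assoc[symmetric] eg)
      also have "\<dots> = g \<bullet> n" using tri[OF n] by (simp add: mult_assoc[symmetric] eg)
      finally show ?thesis using gnf by (simp add: g_def mult_diff_right)
    qed
    from less.hyps[OF dims[OF g(1,3)] F g(2) this]
    obtain u where u: "Vector_Spaces.linear scale (*) u" "\<And>n. n \<in> F 1 \<Longrightarrow> u (g \<bullet> n \<bullet> g) = 0"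
      "\<And>x. x \<in> corner g \<Longrightarrow> (\<And>a. u (g \<bullet> a \<bullet> x) = 0) \<Longrightarrow> x = 0" by metis
    have "f \<bullet> n \<bullet> f = f \<bullet> n" if "n \<in> trivial_filtration 1" for n
      using that by (simp add: trivial_filtration_def mult_distribs)
    from less.hyps[OF dims[OF f(1,4)] filtration_trivial f(2) this]
    obtain s where s: "Vector_Spaces.linear scale (*) s"
      "\<And>x. x \<in> corner f \<Longrightarrow> (\<And>a. s (f \<bullet> a \<bullet> x) = 0) \<Longrightarrow> x = 0" by metis
    interpret s: Vector_Spaces.linear scale "(*)" s by (rule s)
    interpret u: Vector_Spaces.linear scale "(*)" u by (rule u)
    define t where "t z = s (f \<bullet> z \<bullet> f) + u (g \<bullet> z \<bullet> g)" for z
    have "Vector_Spaces.linear scale (*) t"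
      by unfold_locales
        (simp_all add: t_def mult_distribs mult_scale_left mult_scale_right
          s.add u.add s.scale u.scale algebra_simps)
    moreover have "t (e \<bullet> n \<bullet> e) = 0" if n: "n \<in> F 1" for n
    proof -
      have "f \<bullet> (e \<bullet> n \<bullet> e) \<bullet> f = f \<bullet> (e \<bullet> n \<bullet> f)"
        by (simp add: mult_assoc ef)
      then have 1: "f \<bullet> (e \<bullet> n \<bullet> e) \<bullet> f = 0" using kill[OF n] by (simp add: mult_distribs)
      have "g \<bullet> (e \<bullet> n \<bullet> e) \<bullet> g = (g \<bullet> e) \<bullet> n \<bullet> (e \<bullet> g)" by (simp add: mult_assoc)
      then have 2: "g \<bullet> (e \<bullet> n \<bullet> e) \<bullet> g = g \<bullet> n \<bullet> g" by (simp add: eg)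
      show ?thesis unfolding t_def 1 2 using u(2)[OF n] s.zero by simp
    qed
    moreover have "x = 0" if x: "x \<in> corner e" and t0: "\<And>a. t (e \<bullet> a \<bullet> x) = 0" for x
    proof -
      have xh: "x \<bullet> h = 0" if h: "h \<bullet> h = h" and "e \<bullet> h = h"
        and nondeg: "\<And>y. y \<in> corner h \<Longrightarrow> (\<And>a. v (h \<bullet> a \<bullet> y) = 0) \<Longrightarrow> y = 0"
        and v: "\<And>a. t (h \<bullet> a) = v (h \<bullet> a \<bullet> h)" for h v
      proof (rule semiprimeD[OF \<open>semiprime\<close>])
        fix b
        have "h \<bullet> b \<bullet> x \<bullet> h = 0"
        proof (rule nondeg)
          show "h \<bullet> b \<bullet> x \<bullet> h \<in> corner h"
            by (simp add: corner_def mult_assoc h) (simp add: mult_assoc[symmetric] h)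
          fix a
          have "v (h \<bullet> a \<bullet> (h \<bullet> b \<bullet> x \<bullet> h)) = t (h \<bullet> (a \<bullet> h \<bullet> b \<bullet> x))"
            unfolding v by (simp add: mult_assoc)
          also have "\<dots> = t (e \<bullet> (h \<bullet> a \<bullet> h \<bullet> b) \<bullet> x)"
            using \<open>e \<bullet> h = h\<close> by (simp add: mult_assoc[symmetric])
          finally show "v (h \<bullet> a \<bullet> (h \<bullet> b \<bullet> x \<bullet> h)) = 0" using t0 by simp
        qed
        then have "x \<bullet> (h \<bullet> b \<bullet> x \<bullet> h) = 0" by (simp add: mult_distribs)
        then show "x \<bullet> h \<bullet> b \<bullet> (x \<bullet> h) = 0" by (simp add: mult_assoc)
      qed
      have "x \<bullet> f = 0"
      proof (rule xh[OF f(2) ef(1) s(2)])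
        show "t (f \<bullet> a) = s (f \<bullet> a \<bullet> f)" for a
          using u.zero by (simp add: t_def mult_assoc[symmetric] f fg mult_distribs)
      qed
      moreover have "x \<bullet> g = 0"
      proof (rule xh[OF g(2) eg(1) u(3)])
        show "t (g \<bullet> a) = u (g \<bullet> a \<bullet> g)" for a
          using s.zero by (simp add: t_def mult_assoc[symmetric] g fg mult_distribs)
      qed
      ultimately show "x = 0" using x by (simp add: g_def corner_def mult_diff_right)
    qed
    ultimately show ?thesis by blast
  next
    case False
    have en: "e \<bullet> n = 0" if n: "n \<in> F 1" for n
    proof (rule ccontr)
      assume "e \<bullet> n \<noteq> 0"
      obtain f where "f \<in> corner e" "f \<bullet> f = f" "f \<noteq> 0" "f \<noteq> e" "\<And>n. n \<in> F 1 \<Longrightarrow> e \<bullet> n \<bullet> f = 0"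
        by (rule idempotent_killed_by_positive_part
            [OF \<open>semiprime\<close> F e tri n \<open>e \<bullet> n \<noteq> 0\<close>]) auto
      with False show False by blast
    qed
    have noidem: "f = 0 \<or> f = e" if "f \<in> corner e" "f \<bullet> f = f" for f
      using False that en by (metis mult_zero_left)
    show ?thesis
    proof (cases "e = 0")
      case True
      have "Vector_Spaces.linear scale (*) (\<lambda>_. 0 :: 'k)" by (rule vs.linear_zero)
      with True show ?thesis by (intro exI[of _ "\<lambda>_. 0"]) (auto simp: corner_def mult_distribs)
    next
      case False
      then obtain t where t: "Vector_Spaces.linear scale (*) t" "t e \<noteq> (0::'k)"
        by (rule obtain_functional)
      interpret t: Vector_Spaces.linear scale "(*)" t by (rule t)
      have "x = 0" if x: "x \<in> corner e" and t0: "\<And>a. t (e \<bullet> a \<bullet> x) = 0" for x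
      proof (rule ccontr)
        assume "x \<noteq> 0"
        then obtain y where y: "y \<in> corner e" "y \<bullet> x = e"
          using corner_without_idempotents_inverse[OF \<open>semiprime\<close> e noidem x] by blast
        then have "e \<bullet> y \<bullet> x = e" by (simp add: corner_def)
        with t0[of y] t(2) show False by simp
      qed
      moreover have "\<forall>n \<in> F 1. t (e \<bullet> n \<bullet> e) = 0" using en t.zero by (simp add: mult_distribs)
      ultimately show ?thesis using t(1) by blast
    qed
  qed
qed

lemma filtration_functional:
  assumes "semiprime" and "filtration F"
  shows "\<exists>t. Vector_Spaces.linear scale (*) t \<and> (\<forall>n \<in> F 1. t n = (0::'k)) \<and>
    (\<forall>x. (\<forall>a. t (a \<bullet> x) = 0) \<longrightarrow> x = 0)"
proof -
  obtain e where e: "\<And>x. e \<bullet> x = x" "\<And>x. x \<bullet> e = x" using semiprime_unit[OF assms(1)] by blast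
  then have "e \<bullet> e = e" "\<And>n. n \<in> F 1 \<Longrightarrow> e \<bullet> n \<bullet> e = e \<bullet> n" by simp_all
  from corner_functional[OF assms this]
  obtain t where t: "Vector_Spaces.linear scale (*) t" "\<And>n. n \<in> F 1 \<Longrightarrow> t (e \<bullet> n \<bullet> e) = (0::'k)"
    "\<And>x. x \<in> corner e \<Longrightarrow> (\<And>a. t (e \<bullet> a \<bullet> x) = 0) \<Longrightarrow> x = 0" by metis
  have "t n = 0" if "n \<in> F 1" for n using t(2)[OF that] by (simp add: e)
  moreover have "x = 0" if "\<forall>a. t (a \<bullet> x) = 0" for x
    using that by (intro t(3)) (simp_all add: e corner_def)
  ultimately show ?thesis using t(1) by blast
qed

end


section \<open>Weights of filtrations\<close>

context fd_algebra
begin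

lemma dim_le_card_functionals:
  assumes "finite D" and "\<And>d. d \<in> D \<Longrightarrow> Vector_Spaces.linear scale (*) (\<phi> d)"
    and "subspace W" and "\<And>w. w \<in> W \<Longrightarrow> (\<And>d. d \<in> D \<Longrightarrow> \<phi> d w = (0::'k)) \<Longrightarrow> w = 0"
  shows "dim W \<le> card D"
  using assms
proof (induction D arbitrary: W rule: finite_induct)
  case empty
  then have "W \<subseteq> {0}" by auto
  then show ?case using dim_mono[of W "{0}"] by simp
next
  case (insert d D)
  obtain B where "finite_dimensional_vector_space scale B" by (rule obtain_basis)
  then interpret fin: finite_dimensional_vector_space scale B .
  interpret d: Vector_Spaces.linear scale "(*)" "\<phi> d" by (rule insert.prems) simp
  let ?W = "{w \<in> W. \<phi> d w = 0}"
  have W: "subspace ?W"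
    using insert.prems(2)
    by (auto intro!: subspaceI simp: d.zero d.add d.scale subspace_0 subspace_add subspace_scale)
  have IH: "dim ?W \<le> card D"
  proof (rule insert.IH[OF _ W])
    show "Vector_Spaces.linear scale (*) (\<phi> d')" if "d' \<in> D" for d'
      using insert.prems(1) that by blast
    show "w = 0" if "w \<in> ?W" "\<And>d'. d' \<in> D \<Longrightarrow> \<phi> d' w = 0" for w
      using that by (intro insert.prems(3)) auto
  qed
  show ?case
  proof (cases "?W = W")
    case True
    with IH insert.hyps show ?thesis by simp
  next
    case False
    then obtain v where v: "v \<in> W" "\<phi> d v \<noteq> 0" by blast
    have "W \<subseteq> span (insert v ?W)"
    proof
      fix w assume w: "w \<in> W"
      define c where "c = \<phi> d w / \<phi> d v"
      have "w - c *s v \<in> ?W"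
        using v w insert.prems(2)
        by (simp add: d.diff d.scale c_def subspace_diff subspace_scale)
      then show "w \<in> span (insert v ?W)"
        unfolding span_breakdown_eq by (intro exI[of _ c]) (rule span_base)
    qed
    then have "dim W \<le> dim (span (insert v ?W))" by (rule dim_mono)
    also have "\<dots> \<le> dim ?W + 1" unfolding dim_span by (simp add: fin.dim_insert)
    finally show ?thesis using IH insert.hyps by simp
  qed
qed

text \<open>Extend a basis of \<open>U\<close> to a basis of the whole space. The new basis vectors \<open>d\<close> give functionals
  \<open>w \<mapsto> t (d \<bullet> w)\<close> whose only common zero in \<open>W\<close> is \<open>0\<close>, because the vectors of \<open>U\<close> already pair to zero
  with \<open>W\<close>.\<close>

lemma dim_orthogonal_le:
  assumes t: "Vector_Spaces.linear scale (*) t"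
    and nondeg: "\<And>x. (\<And>a. t (a \<bullet> x) = (0::'k)) \<Longrightarrow> x = 0"
    and U: "subspace U" and W: "subspace W"
    and orth: "\<And>x y. x \<in> U \<Longrightarrow> y \<in> W \<Longrightarrow> t (x \<bullet> y) = 0"
  shows "dim U + dim W \<le> dim UNIV"
proof -
  interpret t: Vector_Spaces.linear scale "(*)" t by (rule t)
  obtain B where B: "B \<subseteq> U" "independent B" "U \<subseteq> span B" "card B = dim U"
    by (rule basis_exists)
  obtain C where C: "B \<subseteq> C" "C \<subseteq> UNIV" "independent C" "UNIV \<subseteq> span C"
    using B(2) by (rule maximal_independent_subset_extend[OF subset_UNIV])
  obtain S where S: "finite S" "span S = UNIV" using finite_dim by blast
  have finC: "finite C" using independent_span_bound[OF S(1) C(3)] S(2) by simp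
  have cardC: "card C = dim UNIV" using basis_card_eq_dim[OF C(2,4,3)] .
  have "dim W \<le> card (C - B)"
  proof (rule dim_le_card_functionals[OF _ _ W, where \<phi> = "\<lambda>d w. t (d \<bullet> w)"])
    show "finite (C - B)" using finC by simp
    show "Vector_Spaces.linear scale (*) (\<lambda>w. t (d \<bullet> w))" for d
      by unfold_locales
        (simp_all add: mult_add_right mult_scale_right t.add t.scale algebra_simps)
    fix w assume w: "w \<in> W" and zero: "\<And>d. d \<in> C - B \<Longrightarrow> t (d \<bullet> w) = 0"
    have "t (a \<bullet> w) = 0" for a
    proof -
      have "a \<in> span C" using C(4) by blast
      then show ?thesis
      proof (induction rule: span_induct_alt)
        case base
        then show ?case by (simp add: t.zero mult_zero_left)
      next
        case (step c x y)
        have "t (x \<bullet> w) = 0"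
        proof (cases "x \<in> B")
          case True
          with B(1) w orth show ?thesis by blast
        next
          case False
          with step zero show ?thesis by blast
        qed
        with step show ?case by (simp add: mult_add_left mult_scale_left t.add t.scale)
      qed
    qed
    then show "w = 0" by (rule nondeg)
  qed
  also have "\<dots> = dim UNIV - dim U"
    using card_Diff_subset[OF finite_subset[OF C(1) finC] C(1)] cardC B(4) by simp
  finally show ?thesis using dim_mono[of U UNIV] by simp
qed

lemma filtration_window:
  assumes "filtration F"
  obtains K where "\<And>i. i \<le> - int K \<Longrightarrow> F i = UNIV" "\<And>i. i > int K \<Longrightarrow> F i = {0}"
proof -
  obtain a b where a: "\<And>i. i \<le> a \<Longrightarrow> F i = UNIV" and b: "\<And>i. i \<ge> b \<Longrightarrow> F i = {0}"
    using filtration_top[OF assms] filtration_bot[OF assms] by blast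
  show thesis
  proof (rule that[of "nat (\<bar>a\<bar> + \<bar>b\<bar>)"])
    show "F i = UNIV" if "i \<le> - int (nat (\<bar>a\<bar> + \<bar>b\<bar>))" for i using that by (intro a) linarith
    show "F i = {0}" if "i > int (nat (\<bar>a\<bar> + \<bar>b\<bar>))" for i using that by (intro b) linarith
  qed
qed

lemma weights_window:
  assumes "\<And>i. i \<le> - int K \<Longrightarrow> F i = UNIV" "\<And>i. i > int K \<Longrightarrow> F i = {0}"
  shows "weights F \<subseteq> {- int K..int K}"
proof
  fix m assume "m \<in> weights F"
  then have "F m \<noteq> F (m + 1)" by (simp add: weights_def)
  moreover have "F m = F (m + 1)" if "m < - int K" using assms(1)[of m] assms(1)[of "m + 1"] that by simp
  moreover have "F m = F (m + 1)" if "m > int K" using assms(2)[of m] assms(2)[of "m + 1"] that by simp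
  ultimately show "m \<in> {- int K..int K}" by force
qed

lemma finite_weights:
  assumes "filtration F" shows "finite (weights F)"
proof -
  obtain K where "\<And>i. i \<le> - int K \<Longrightarrow> F i = UNIV" "\<And>i. i > int K \<Longrightarrow> F i = {0}"
    by (rule filtration_window[OF assms]) blast
  from finite_subset[OF weights_window[OF this]] show ?thesis by simp
qed

lemma sum_weights:
  assumes "finite S" "weights F \<subseteq> S"
  shows "(\<Sum>m\<in>weights F. c m * gr_dim F m) = (\<Sum>m\<in>S. c m * gr_dim F m)"
  using assms by (intro sum.mono_neutral_left) (auto simp: weights_def gr_dim_def)

lemma gr_dim_nonneg:
  assumes "filtration F" shows "gr_dim F m \<ge> 0"
  using dim_mono[OF filtration_antimono[OF assms, of m "m + 1"]] by (simp add: gr_dim_def)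

lemma gr_dim_eq_0_imp:
  assumes "filtration F" "gr_dim F m = 0" shows "F m = F (m + 1)"
proof (rule sym, rule subspace_eqI_dim)
  show "F (m + 1) \<subseteq> F m" by (rule filtration_antimono[OF assms(1)]) simp
  show "dim (F m) \<le> dim (F (m + 1))" using assms(2) by (simp add: gr_dim_def)
qed (rule filtration_subspace[OF assms(1)])+

lemma sum_gr_dim:
  assumes "filtration F"
  shows "(\<Sum>m\<in>weights F. gr_dim F m) = int (dim UNIV)"
proof -
  obtain K where K: "\<And>i. i \<le> - int K \<Longrightarrow> F i = UNIV" "\<And>i. i > int K \<Longrightarrow> F i = {0}"
    by (rule filtration_window[OF assms]) blast
  have tele: "(\<Sum>m\<in>{- int k..int k}. d m - d (m + 1)) = d (- int k) - d (int k + 1)"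
    for d :: "int \<Rightarrow> int" and k
  proof (induction k)
    case (Suc k)
    have "{- int (Suc k)..int (Suc k)} =
      insert (- 1 - int k) (insert (1 + int k) {- int k..int k})" by auto
    with Suc show ?case by (simp add: algebra_simps)
  qed simp
  have "(\<Sum>m\<in>weights F. gr_dim F m) = (\<Sum>m\<in>{- int K..int K}. gr_dim F m)"
    using sum_weights[OF _ weights_window[OF K], where c = "\<lambda>_. 1"] by simp
  also have "\<dots> = int (dim UNIV)"
    using tele[of "\<lambda>m. int (dim (F m))" K] K by (simp add: gr_dim_def)
  finally show ?thesis .
qed

lemma filtration_constant_off:
  assumes F: "filtration F" and c: "weights F \<subseteq> {c}"
  shows "F n = (if n \<le> c then UNIV else {0})"
proof -
  obtain K where K: "\<And>i. i \<le> - int K \<Longrightarrow> F i = UNIV" "\<And>i. i > int K \<Longrightarrow> F i = {0}"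
    by (rule filtration_window[OF F]) blast
  have const: "F (m + 1) = F m" if "m \<noteq> c" for m using that c by (auto simp: weights_def)
  have "n \<le> c \<longrightarrow> F n = UNIV"
  proof (cases "n \<le> - int K")
    case False
    then have "- int K \<le> n" by simp
    then show ?thesis by (induction n rule: int_ge_induct) (auto simp: K const)
  qed (simp add: K)
  moreover have "n > c \<longrightarrow> F n = {0}"
  proof (cases "n > int K")
    case False
    then have "n \<le> int K + 1" by simp
    then show ?thesis
    proof (induction n rule: int_le_induct)
      case (step i)
      have "F i = F (i - 1)" if "i - 1 \<noteq> c" using const[OF that] by simp
      with step.IH show ?case by force
    qed (simp add: K)
  qed (simp add: K)
  ultimately show ?thesis by auto
qed

definition second_moment :: "(int \<Rightarrow> 'b set) \<Rightarrow> int" where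
  "second_moment F = (\<Sum>m\<in>weights F. m\<^sup>2 * gr_dim F m)"

lemma filtration_norm_eq: "filtration_norm F = sqrt (real_of_int (second_moment F))"
  by (simp add: filtration_norm_def second_moment_def)

lemma second_moment_nonneg: "filtration F \<Longrightarrow> second_moment F \<ge> 0"
  unfolding second_moment_def by (intro sum_nonneg) (simp add: gr_dim_nonneg)

lemma second_moment_zero_imp_trivial:
  assumes F: "filtration F" and "second_moment F = 0"
  shows "F = trivial_filtration"
proof -
  have "m\<^sup>2 * gr_dim F m = 0" if "m \<in> weights F" for m
    using assms(2) that finite_weights[OF F] gr_dim_nonneg[OF F]
    by (simp add: second_moment_def sum_nonneg_eq_0_iff)
  then have "weights F \<subseteq> {0}" using gr_dim_eq_0_imp[OF F] by (auto simp: weights_def)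
  from filtration_constant_off[OF F this] show ?thesis
    by (auto simp: trivial_filtration_def fun_eq_iff)
qed

text \<open>Up to normalization this is the variance of the weights, each counted with its multiplicity.
  The left-hand side is nonnegative, which is the Cauchy--Schwarz inequality, and it vanishes only if
  every weight equals the mean.\<close>

lemma variance_identity:
  assumes "filtration F"
  defines "d \<equiv> int (dim UNIV)"
  shows "(\<Sum>m\<in>weights F. (d * m - wt F)\<^sup>2 * gr_dim F m) = d * (d * second_moment F - (wt F)\<^sup>2)"
proof -
  have "(\<Sum>m\<in>weights F. (d * m - wt F)\<^sup>2 * gr_dim F m) =
      (\<Sum>m\<in>weights F. d\<^sup>2 * (m\<^sup>2 * gr_dim F m) - 2 * d * wt F * (m * gr_dim F m)
        + (wt F)\<^sup>2 * gr_dim F m)"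
    by (intro sum.cong refl) (simp add: power2_eq_square algebra_simps)
  also have "\<dots> = d\<^sup>2 * second_moment F - 2 * d * wt F * wt F + (wt F)\<^sup>2 * d"
    unfolding second_moment_def
    by (simp add: sum.distrib sum_subtractf sum_distrib_left[symmetric] sum_gr_dim[OF assms(1)] d_def
        wt_def[of F, symmetric])
  finally show ?thesis by (simp add: power2_eq_square algebra_simps)
qed

lemma wt_square_le:
  assumes F: "filtration F"
  shows "(wt F)\<^sup>2 \<le> int (dim UNIV) * second_moment F"
proof (cases "dim UNIV = 0")
  case True
  then have "dim (F m) = 0" for m using dim_mono[OF subset_UNIV, of "F m"] by simp
  then have "F m = F (m + 1)" for m by (intro gr_dim_eq_0_imp[OF F]) (simp add: gr_dim_def)
  then have "weights F = {}" by (simp add: weights_def)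
  with True show ?thesis by (simp add: wt_def)
next
  case False
  have "0 \<le> (\<Sum>m\<in>weights F. (int (dim UNIV) * m - wt F)\<^sup>2 * gr_dim F m)"
    by (intro sum_nonneg) (simp add: gr_dim_nonneg[OF F])
  with False show ?thesis by (simp add: variance_identity[OF F] zero_le_mult_iff)
qed

lemma single_weight:
  assumes F: "filtration F" and pos: "wt F > 0"
    and eq: "(wt F)\<^sup>2 = int (dim UNIV) * second_moment F"
  obtains c where "c \<ge> 1" "\<And>n. F n = (if n \<le> c then UNIV else {0})"
proof -
  let ?d = "int (dim UNIV)"
  have d: "?d > 0" using eq pos by (cases "dim UNIV = 0") auto
  have mean: "?d * m = wt F" if m: "m \<in> weights F" for m
  proof -
    have "(\<Sum>m\<in>weights F. (?d * m - wt F)\<^sup>2 * gr_dim F m) = 0"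
      using variance_identity[OF F] eq by simp
    then have "(?d * m - wt F)\<^sup>2 * gr_dim F m = 0"
      using m finite_weights[OF F] gr_dim_nonneg[OF F] by (simp add: sum_nonneg_eq_0_iff)
    moreover have "gr_dim F m \<noteq> 0" using m gr_dim_eq_0_imp[OF F] by (auto simp: weights_def)
    ultimately show ?thesis by simp
  qed
  have "weights F \<noteq> {}" using pos by (auto simp: wt_def)
  then obtain c where c: "c \<in> weights F" by blast
  have "?d * c > 0" using mean[OF c] pos by simp
  then have "c \<ge> 1" using d by (simp add: zero_less_mult_iff)
  moreover have "m = c" if "m \<in> weights F" for m
    using mean[OF that] mean[OF c] d by (metis less_irrefl mult_cancel_left)
  then have "weights F \<subseteq> {c}" by blast
  ultimately show thesis using filtration_constant_off[OF F] that by blast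
qed

lemma abel_summation_symmetric:
  fixes d :: "int \<Rightarrow> int"
  shows "(\<Sum>m\<in>{- int k..int k}. m * (d m - d (m + 1))) =
    (\<Sum>j<k. d (1 + int j) + d (- int j)) - int k * (d (- int k) + d (int k + 1))"
proof (induction k)
  case (Suc k)
  have "{- int (Suc k)..int (Suc k)} =
    insert (- 1 - int k) (insert (1 + int k) {- int k..int k})" by auto
  with Suc show ?case by (simp add: algebra_simps)
qed simp

text \<open>\<open>F (1 + j) F (- j) \<subseteq> F 1\<close> lies in the kernel of the functional adapted to \<open>F\<close>, so these two
  subspaces are orthogonal for a nondegenerate form and their dimensions add up to at most
  \<open>dim A\<close>. Summation over \<open>j\<close> bounds the weight.\<close>

lemma semiprime_wt_nonpos:
  assumes "semiprime" and F: "filtration F"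
  shows "wt F \<le> 0"
proof -
  obtain t where t: "Vector_Spaces.linear scale (*) t" "\<And>n. n \<in> F 1 \<Longrightarrow> t n = (0::'k)"
    "\<And>x. (\<And>a. t (a \<bullet> x) = 0) \<Longrightarrow> x = 0"
    using filtration_functional[OF assms] by metis
  have orth: "int (dim (F (1 + int j))) + int (dim (F (- int j))) \<le> int (dim UNIV)" for j
  proof -
    have "dim (F (1 + int j)) + dim (F (- int j)) \<le> dim UNIV"
    proof (rule dim_orthogonal_le[OF t(1,3)])
      show "t (x \<bullet> y) = 0" if "x \<in> F (1 + int j)" "y \<in> F (- int j)" for x y
        using filtration_mult[OF F that] by (intro t(2)) simp
    qed (auto intro: filtration_subspace[OF F])
    then show ?thesis by linarith
  qed
  obtain K where K: "\<And>i. i \<le> - int K \<Longrightarrow> F i = UNIV" "\<And>i. i > int K \<Longrightarrow> F i = {0}"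
    by (rule filtration_window[OF F]) blast
  have "wt F = (\<Sum>m\<in>{- int K..int K}. m * gr_dim F m)"
    unfolding wt_def by (rule sum_weights[OF _ weights_window[OF K]]) auto
  also have "\<dots> = (\<Sum>j<K. int (dim (F (1 + int j))) + int (dim (F (- int j)))) - int K * int (dim UNIV)"
    using abel_summation_symmetric[of "\<lambda>m. int (dim (F m))" K] K by (simp add: gr_dim_def)
  also have "\<dots> \<le> 0"
    using sum_bounded_above[of "{..<K}" "\<lambda>j. int (dim (F (1 + int j))) + int (dim (F (- int j)))"
        "int (dim UNIV)"] orth by simp
  finally show ?thesis .
qed

end


section \<open>Filtrations of a trivial extension\<close>

text \<open>The rescalings of the filtration of the theorem by positive integers \<open>c\<close>: \<open>A\<close> has weight \<open>0\<close>
  and \<open>M\<close> has weight \<open>c\<close>.\<close>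

definition stretched_filtration :: "int \<Rightarrow> int \<Rightarrow> ('a::ab_group_add \<times> 'm::ab_group_add) set" where
  "stretched_filtration c n = (if n \<le> 0 then UNIV else if n \<le> c then {0} \<times> UNIV else {0})"

lemma Pair_eq_0_iff: "(a, b) = 0 \<longleftrightarrow> a = 0 \<and> b = 0"
  by (simp add: prod_eq_iff)

lemma Pair_mem_stretched_iff:
  "c \<ge> 0 \<Longrightarrow> (a, m) \<in> stretched_filtration c n \<longleftrightarrow> (n \<le> 0 \<or> a = 0) \<and> (n \<le> c \<or> m = 0)"
  by (auto simp: stretched_filtration_def Pair_eq_0_iff)

lemma trivial_ext_eq_stretched: "trivial_ext_filtration = stretched_filtration 1"
  by (auto simp: fun_eq_iff trivial_ext_filtration_def stretched_filtration_def)

lemma ceiling_divide_le_iff: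
  assumes "c > 0"
  shows "\<lceil>real_of_int n / real_of_int c\<rceil> \<le> k \<longleftrightarrow> n \<le> k * c"
proof -
  have "\<lceil>real_of_int n / real_of_int c\<rceil> \<le> k \<longleftrightarrow> real_of_int n \<le> real_of_int k * real_of_int c"
    using assms by (simp add: ceiling_le_iff pos_divide_le_eq)
  also have "\<dots> \<longleftrightarrow> n \<le> k * c" by (simp flip: of_int_mult)
  finally show ?thesis .
qed

lemma rescale_stretched:
  assumes "q > 0"
  shows "rescale q (stretched_filtration 1) n = stretched_filtration q n"
  using ceiling_divide_le_iff[OF assms, of n 0] ceiling_divide_le_iff[OF assms, of n 1]
  by (simp add: rescale_def stretched_filtration_def)

text \<open>A rescaling by \<open>q / p\<close> puts \<open>M\<close> in weight \<open>q / p\<close>, which must be an integer: all jumps of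
  \<open>rescale p F\<close> occur at multiples of \<open>p\<close>, and the other side jumps at \<open>q\<close> since \<open>M \<noteq> 0\<close>.\<close>

lemma rescaling_equivalent_stretched_iff:
  assumes ne: "(UNIV :: 'm::ab_group_add set) \<noteq> {0}"
  shows "rescaling_equivalent F (trivial_ext_filtration :: int \<Rightarrow> ('a::ab_group_add \<times> 'm) set) \<longleftrightarrow>
    (\<exists>c\<ge>1. F = stretched_filtration c)"
proof
  assume "rescaling_equivalent F (trivial_ext_filtration :: int \<Rightarrow> ('a \<times> 'm) set)"
  then obtain p q where p: "p > 0" and q: "q > 0"
    and eq: "rescale p F = rescale q (stretched_filtration 1 :: int \<Rightarrow> ('a \<times> 'm) set)"
    unfolding rescaling_equivalent_def trivial_ext_eq_stretched by blast
  have at: "F \<lceil>real_of_int n / real_of_int p\<rceil> = stretched_filtration q n" for n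
    using fun_cong[OF eq, of n] rescale_stretched[OF q, of n] by (simp add: rescale_def)
  have F: "F n = stretched_filtration q (p * n)" for n
    using at[of "p * n"] p by simp
  define c where "c = \<lceil>real_of_int q / real_of_int p\<rceil>"
  have c1: "c \<ge> 1" using q p by (simp add: c_def)
  have sets: "{0} \<times> (UNIV :: 'm set) \<noteq> ({0} :: ('a \<times> 'm) set)"
  proof
    assume *: "{0} \<times> (UNIV :: 'm set) = ({0} :: ('a \<times> 'm) set)"
    have "m = 0" for m :: 'm
    proof -
      have "(0, m) \<in> ({0} :: ('a \<times> 'm) set)" unfolding *[symmetric] by simp
      then show ?thesis by (simp add: zero_prod_def)
    qed
    with ne show False by auto
  qed
  have "F c = {0} \<times> UNIV" using at[of q] q by (simp add: c_def stretched_filtration_def)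
  moreover have "0 < p * c" using p c1 by simp
  ultimately have pc: "p * c \<le> q"
    using F[of c] sets by (auto simp: stretched_filtration_def split: if_splits)
  have "q \<le> p * c"
    using ceiling_divide_le_iff[OF p, of q c] by (simp add: c_def mult.commute)
  with pc have qc: "q = p * c" by simp
  have "F n = stretched_filtration c n" for n
    unfolding F[of n] stretched_filtration_def qc using p by (simp add: mult_le_0_iff)
  with c1 show "\<exists>c\<ge>1. F = stretched_filtration c" by (intro exI[of _ c]) (simp add: fun_eq_iff)
next
  assume "\<exists>c\<ge>1. F = stretched_filtration c"
  then obtain c where c: "c \<ge> 1" "F = stretched_filtration c" by blast
  have "rescale 1 F = rescale c (stretched_filtration 1)"
    using c by (simp add: fun_eq_iff rescale_stretched) (simp add: rescale_def)
  then show "rescaling_equivalent F trivial_ext_filtration"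
    unfolding rescaling_equivalent_def trivial_ext_eq_stretched
    using c(1) by (intro exI[of _ 1] exI[of _ c]) auto
qed

lemma rescaling_equivalent_const_iff:
  assumes inv: "\<And>c n. c > 0 \<Longrightarrow> rescale c G n = G n"
  shows "rescaling_equivalent F G \<longleftrightarrow> F = G"
proof
  assume "rescaling_equivalent F G"
  then obtain p q where pq: "p > 0" "q > 0" "rescale p F = rescale q G"
    unfolding rescaling_equivalent_def by blast
  have "F n = G n" for n
  proof -
    have "F n = rescale p F (p * n)" using pq(1) by (simp add: rescale_def)
    also have "\<dots> = rescale p G (p * n)" using pq inv by simp
    also have "\<dots> = G n" using pq(1) by (simp add: rescale_def)
    finally show ?thesis .
  qed
  then show "F = G" by (simp add: fun_eq_iff)
next
  assume "F = G"
  then show "rescaling_equivalent F G"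
    unfolding rescaling_equivalent_def by (intro exI[of _ 1]) simp
qed

context fd_bimodule
begin

text \<open>\<open>M\<close> is a square-zero ideal of the extension with quotient \<open>A\<close>. It is treated as an algebra
  with zero multiplication, so that the induced filtrations of \<open>M\<close> and of \<open>A\<close> fall under the same
  notion.\<close>

sublocale M0: fd_algebra scaleM "\<lambda>_ _. 0"
  by unfold_locales (auto simp: finite_dim_M)

definition quotient_filtration :: "(int \<Rightarrow> ('a \<times> 'm) set) \<Rightarrow> int \<Rightarrow> 'a set" where
  "quotient_filtration F n = fst ` F n"

definition sub_filtration :: "(int \<Rightarrow> ('a \<times> 'm) set) \<Rightarrow> int \<Rightarrow> 'm set" where
  "sub_filtration F n = {m. (0, m) \<in> F n}"

lemma linear_fst: "Vector_Spaces.linear AM.scale scaleA fst"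
  by unfold_locales (auto simp: AM.scale_prod)

lemma linear_snd: "Vector_Spaces.linear AM.scale scaleM snd"
  by unfold_locales (auto simp: AM.scale_prod)

lemma subspace_sub:
  assumes "AM.p.subspace V" shows "M.subspace {m. (0, m) \<in> V}"
proof (rule M.subspaceI)
  show "0 \<in> {m. (0, m) \<in> V}" using AM.p.subspace_0[OF assms] unfolding zero_prod_def by blast
next
  fix x y assume "x \<in> {m. (0, m) \<in> V}" "y \<in> {m. (0, m) \<in> V}"
  then show "x + y \<in> {m. (0, m) \<in> V}"
    using AM.p.subspace_add[OF assms, of "(0, x)" "(0, y)"] by simp
next
  fix c x assume "x \<in> {m. (0, m) \<in> V}"
  then show "c *m x \<in> {m. (0, m) \<in> V}"
    using AM.p.subspace_scale[OF assms, of "(0, x)" c] by (simp add: AM.scale_prod)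
qed

lemma dim_extension:
  assumes V: "AM.p.subspace V"
  shows "int (AM.p.dim V) = int (A.dim (fst ` V)) + int (M.dim {m. (0, m) \<in> V})"
proof -
  let ?W = "{x \<in> V. fst x = 0}"
  interpret fst: Vector_Spaces.linear AM.scale scaleA fst by (rule linear_fst)
  have W: "AM.p.subspace ?W"
  proof (rule AM.p.subspaceI)
    show "0 \<in> ?W" using AM.p.subspace_0[OF V] by (simp add: fst.zero)
    show "x + y \<in> ?W" if "x \<in> ?W" "y \<in> ?W" for x y
      using that AM.p.subspace_add[OF V] by (simp add: fst.add)
    show "AM.scale c x \<in> ?W" if "x \<in> ?W" for c x
      using that AM.p.subspace_scale[OF V] by (simp add: fst.scale)
  qed
  have 1: "int (A.dim (fst ` V)) = int (AM.p.dim V) - int (AM.p.dim ?W)"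
    by (rule ext.dim_quotient[OF V W _ linear_fst]) auto
  have "int (M.dim (snd ` ?W)) = int (AM.p.dim ?W) - int (AM.p.dim {0})"
  proof (rule ext.dim_quotient[OF W AM.p.subspace_single_0 _ linear_snd])
    show zero: "{0} \<subseteq> ?W" using AM.p.subspace_0[OF V] by auto
    have "x = 0" if "fst x = 0" "snd x = 0" for x :: "'a \<times> 'm"
      using that by (rule prod_eqI[of x 0, unfolded fst_zero snd_zero])
    then have "{x \<in> ?W. snd x = 0} \<subseteq> {0}" by blast
    moreover have "{0} \<subseteq> {x \<in> ?W. snd x = 0}" using zero by simp
    ultimately show "{x \<in> ?W. snd x = 0} = {0}" by (rule antisym)
  qed
  moreover have "snd ` ?W = {m. (0, m) \<in> V}" by force
  ultimately show ?thesis using 1 ext.dim_zero by simp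
qed

lemma filtration_quotient:
  assumes F: "ext.filtration F"
  shows "A.filtration (quotient_filtration F)"
  unfolding A.filtration_def
proof (intro conjI allI impI ballI)
  interpret fst: Vector_Spaces.linear AM.scale scaleA fst by (rule linear_fst)
  show "A.subspace (quotient_filtration F m)" for m
    unfolding quotient_filtration_def
    by (rule fst.subspace_image[OF ext.filtration_subspace[OF F]])
  show "quotient_filtration F j \<subseteq> quotient_filtration F i" if "i \<le> j" for i j
    unfolding quotient_filtration_def using ext.filtration_antimono[OF F that] by (rule image_mono)
  show "x \<bullet> y \<in> quotient_filtration F (i + j)"
    if xy: "x \<in> quotient_filtration F i" "y \<in> quotient_filtration F j" for i j x y
  proof -
    obtain m n where "(x, m) \<in> F i" "(y, n) \<in> F j"
      using xy by (auto simp: quotient_filtration_def)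
    from ext.filtration_mult[OF F this] show ?thesis
      by (force simp: quotient_filtration_def trivial_ext_mult_def)
  qed
  obtain a b where "\<forall>i\<le>a. F i = UNIV" "\<forall>i\<ge>b. F i = {0}"
    using ext.filtration_top[OF F] ext.filtration_bot[OF F] by blast
  then have "\<forall>i\<le>a. quotient_filtration F i = UNIV" "\<forall>i\<ge>b. quotient_filtration F i = {0}"
    by (simp_all add: quotient_filtration_def)
  then show "\<exists>a. \<forall>i\<le>a. quotient_filtration F i = UNIV"
    and "\<exists>b. \<forall>i\<ge>b. quotient_filtration F i = {0}" by blast+
qed

lemma filtration_sub:
  assumes F: "ext.filtration F"
  shows "M0.filtration (sub_filtration F)"
  unfolding M0.filtration_def
proof (intro conjI allI impI ballI)
  show sub: "M.subspace (sub_filtration F m)" for m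
    unfolding sub_filtration_def by (rule subspace_sub[OF ext.filtration_subspace[OF F]])
  show "sub_filtration F j \<subseteq> sub_filtration F i" if "i \<le> j" for i j
    unfolding sub_filtration_def using ext.filtration_antimono[OF F that] by auto
  show "0 \<in> sub_filtration F (i + j)" for i j by (rule M.subspace_0[OF sub])
  obtain a b where "\<forall>i\<le>a. F i = UNIV" "\<forall>i\<ge>b. F i = {0}"
    using ext.filtration_top[OF F] ext.filtration_bot[OF F] by blast
  then have "\<forall>i\<le>a. sub_filtration F i = UNIV" "\<forall>i\<ge>b. sub_filtration F i = {0}"
    by (simp_all add: sub_filtration_def Pair_eq_0_iff)
  then show "\<exists>a. \<forall>i\<le>a. sub_filtration F i = UNIV"
    and "\<exists>b. \<forall>i\<ge>b. sub_filtration F i = {0}" by blast+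
qed

lemma gr_dim_extension:
  assumes F: "ext.filtration F"
  shows "ext.gr_dim F m = A.gr_dim (quotient_filtration F) m + M0.gr_dim (sub_filtration F) m"
  unfolding ext.gr_dim_def A.gr_dim_def M0.gr_dim_def quotient_filtration_def sub_filtration_def
  using dim_extension[OF ext.filtration_subspace[OF F]] by simp

lemma moment_extension:
  fixes c :: "int \<Rightarrow> int"
  assumes F: "ext.filtration F"
  shows "(\<Sum>m\<in>ext.weights F. c m * ext.gr_dim F m) =
    (\<Sum>m\<in>A.weights (quotient_filtration F). c m * A.gr_dim (quotient_filtration F) m) +
    (\<Sum>m\<in>M0.weights (sub_filtration F). c m * M0.gr_dim (sub_filtration F) m)"
proof -
  let ?S = "ext.weights F \<union> A.weights (quotient_filtration F) \<union> M0.weights (sub_filtration F)"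
  have "finite ?S"
    using ext.finite_weights[OF F] A.finite_weights[OF filtration_quotient[OF F]]
      M0.finite_weights[OF filtration_sub[OF F]] by simp
  note sums = ext.sum_weights[OF this, where F = F and c = c]
    A.sum_weights[OF this, where F = "quotient_filtration F" and c = c]
    M0.sum_weights[OF this, where F = "sub_filtration F" and c = c]
  have "ext.weights F \<subseteq> ?S" "A.weights (quotient_filtration F) \<subseteq> ?S"
    "M0.weights (sub_filtration F) \<subseteq> ?S" by blast+
  from sums(1)[OF this(1)] sums(2)[OF this(2)] sums(3)[OF this(3)] show ?thesis
    by (simp add: gr_dim_extension[OF F] distrib_left sum.distrib)
qed

lemma wt_extension:
  "ext.filtration F \<Longrightarrow> ext.wt F = A.wt (quotient_filtration F) + M0.wt (sub_filtration F)"
  unfolding ext.wt_def A.wt_def M0.wt_def by (rule moment_extension)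

lemma second_moment_extension:
  "ext.filtration F \<Longrightarrow> ext.second_moment F =
    A.second_moment (quotient_filtration F) + M0.second_moment (sub_filtration F)"
  unfolding ext.second_moment_def A.second_moment_def M0.second_moment_def by (rule moment_extension)

text \<open>The weight of \<open>F\<close> is at most that of its restriction to \<open>M\<close>, because \<open>A\<close> contributes a
  nonpositive amount, whereas the second moment is at least that of the restriction.\<close>

lemma wt_square_le_extension:
  assumes "A.semiprime" and F: "ext.filtration F" and pos: "ext.wt F > 0"
  shows "(ext.wt F)\<^sup>2 \<le> (M0.wt (sub_filtration F))\<^sup>2"
    and "(M0.wt (sub_filtration F))\<^sup>2 \<le> int (M.dim UNIV) * M0.second_moment (sub_filtration F)"
    and "0 < M0.wt (sub_filtration F)"
    and "M0.second_moment (sub_filtration F) \<le> ext.second_moment F"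
proof -
  have "A.wt (quotient_filtration F) \<le> 0"
    by (rule A.semiprime_wt_nonpos[OF assms(1) filtration_quotient[OF F]])
  then have le: "ext.wt F \<le> M0.wt (sub_filtration F)" by (simp add: wt_extension[OF F])
  with pos show "(ext.wt F)\<^sup>2 \<le> (M0.wt (sub_filtration F))\<^sup>2" by (intro power_mono) auto
  show "0 < M0.wt (sub_filtration F)" using le pos by simp
  show "(M0.wt (sub_filtration F))\<^sup>2 \<le> int (M.dim UNIV) * M0.second_moment (sub_filtration F)"
    by (rule M0.wt_square_le[OF filtration_sub[OF F]])
  show "M0.second_moment (sub_filtration F) \<le> ext.second_moment F"
    using A.second_moment_nonneg[OF filtration_quotient[OF F]]
    by (simp add: second_moment_extension[OF F])
qed

text \<open>The chain of estimates in \<open>wt_square_le_extension\<close> collapses. Equality in Cauchy--Schwarz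
  forces a single weight on \<open>M\<close>, and equality of the second moments of \<open>F\<close> and of its restriction
  to \<open>M\<close> leaves the quotient \<open>A\<close> with second moment zero.\<close>

lemma extremal_filtration_stretched:
  assumes "A.semiprime" and F: "ext.filtration F" and pos: "ext.wt F > 0"
    and ge: "(ext.wt F)\<^sup>2 \<ge> int (M.dim UNIV) * ext.second_moment F"
  shows "\<exists>c\<ge>1. F = stretched_filtration c"
proof -
  let ?Q = "quotient_filtration F" and ?S = "sub_filtration F" and ?d = "int (M.dim UNIV)"
  note le = wt_square_le_extension[OF assms(1-3)]
  have mono: "?d * M0.second_moment ?S \<le> ?d * ext.second_moment F"
    using le(4) by (intro mult_left_mono) auto
  have eq: "(M0.wt ?S)\<^sup>2 = ?d * M0.second_moment ?S"
    and eq': "?d * M0.second_moment ?S = ?d * ext.second_moment F"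
    using le(1,2) mono ge by linarith+
  have "?d \<noteq> 0"
  proof
    assume "?d = 0"
    with eq have "(M0.wt ?S)\<^sup>2 = 0" by simp
    with le(3) show False by simp
  qed
  with eq' have "A.second_moment ?Q = 0" by (simp add: second_moment_extension[OF F])
  then have Q: "?Q = A.trivial_filtration"
    by (rule A.second_moment_zero_imp_trivial[OF filtration_quotient[OF F]])
  obtain c where c: "c \<ge> 1" and S: "\<And>n. ?S n = (if n \<le> c then UNIV else {0})"
    by (rule M0.single_weight[OF filtration_sub[OF F] le(3) eq]) blast
  have "F n = stretched_filtration c n" for n
  proof -
    have Qn: "fst ` F n = (if n \<le> 0 then UNIV else {0})"
      using fun_cong[OF Q, of n] by (simp add: quotient_filtration_def A.trivial_filtration_def)
    have Sn: "(0, m) \<in> F n \<longleftrightarrow> n \<le> c \<or> m = 0" for m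
      using S[of n] by (auto simp: sub_filtration_def set_eq_iff)
    show ?thesis
    proof (cases "n \<le> 0")
      case True
      have "(a, m) \<in> F n" for a m
      proof -
        obtain m' where "(a, m') \<in> F n" using Qn True by (force simp: image_iff)
        moreover have "(0, m - m') \<in> F n" using Sn True c by simp
        ultimately have "(a, m') + (0, m - m') \<in> F n"
          by (rule AM.p.subspace_add[OF ext.filtration_subspace[OF F]])
        then show ?thesis by simp
      qed
      with True show ?thesis by (auto simp: stretched_filtration_def)
    next
      case False
      then have "a = 0" if "(a, m) \<in> F n" for a m using Qn that by force
      then have "(a, m) \<in> F n \<longleftrightarrow> a = 0 \<and> (n \<le> c \<or> m = 0)" for a m using Sn by metis
      with False show ?thesis by (auto simp: stretched_filtration_def Pair_eq_0_iff)
    qed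
  qed
  with c show ?thesis by (auto simp: fun_eq_iff)
qed

lemma filtration_stretched:
  assumes "c \<ge> 1" shows "ext.filtration (stretched_filtration c)"
  unfolding ext.filtration_def
proof (intro conjI allI impI ballI)
  show "AM.p.subspace (stretched_filtration c m)" for m
    by (auto intro!: AM.p.subspaceI simp: stretched_filtration_def AM.scale_prod Pair_eq_0_iff mem_Times_iff)
  show "stretched_filtration c j \<subseteq> stretched_filtration c i" if "i \<le> j" for i j
    using that by (auto simp: stretched_filtration_def mem_Times_iff)
  have zero: "a \<rhd> 0 = 0" "0 \<rhd> m = 0" "0 \<lhd> a = 0" "m \<lhd> 0 = 0" for a m
    using lact_add_right[of a 0 0] lact_add_left[of 0 0 m] ract_add_left[of 0 0 a]
      ract_add_right[of m 0 0] by simp_all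
  fix i j and x y :: "'a \<times> 'm"
  assume xy: "x \<in> stretched_filtration c i" "y \<in> stretched_filtration c j"
  obtain a m a' m' where "x = (a, m)" "y = (a', m')" by (cases x, cases y) blast
  with xy assms show "trivial_ext_mult (\<bullet>) (\<rhd>) (\<lhd>) x y \<in> stretched_filtration c (i + j)"
    by (cases "i \<le> 0"; cases "j \<le> 0")
      (auto simp: Pair_mem_stretched_iff trivial_ext_mult_def zero A.mult_zero_left A.mult_zero_right)
next
  show "\<exists>a. \<forall>i\<le>a. stretched_filtration c i = (UNIV :: ('a \<times> 'm) set)"
    by (intro exI[of _ 0]) (simp add: stretched_filtration_def)
  show "\<exists>b. \<forall>i\<ge>b. stretched_filtration c i = ({0} :: ('a \<times> 'm) set)"
    using assms by (intro exI[of _ "c + 1"]) (simp add: stretched_filtration_def)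
qed

lemma moments_stretched:
  assumes "c \<ge> 1"
  shows "ext.wt (stretched_filtration c) = c * int (M.dim UNIV)"
    and "ext.second_moment (stretched_filtration c) = c\<^sup>2 * int (M.dim UNIV)"
proof -
  let ?E = "stretched_filtration c :: int \<Rightarrow> ('a \<times> 'm) set"
  have sub: "ext.weights ?E \<subseteq> {0, c}"
    using assms by (auto simp: ext.weights_def stretched_filtration_def split: if_splits)
  have "AM.p.subspace ({0} \<times> (UNIV :: 'm set))"
    using ext.filtration_subspace[OF filtration_stretched[OF assms], of c] assms
    by (simp add: stretched_filtration_def)
  from dim_extension[OF this] have "int (AM.p.dim ({0} \<times> (UNIV :: 'm set))) = int (M.dim UNIV)"
    by (simp add: A.dim_zero)
  then have gr: "ext.gr_dim ?E c = int (M.dim UNIV)"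
    using assms ext.dim_zero by (simp add: ext.gr_dim_def stretched_filtration_def)
  have "c \<noteq> 0" using assms by simp
  then show "ext.wt ?E = c * int (M.dim UNIV)"
    unfolding ext.wt_def by (subst ext.sum_weights[OF _ sub]) (simp_all add: gr)
  show "ext.second_moment ?E = c\<^sup>2 * int (M.dim UNIV)"
    unfolding ext.second_moment_def using \<open>c \<noteq> 0\<close>
    by (subst ext.sum_weights[OF _ sub]) (simp_all add: gr)
qed

lemma nu_stretched:
  assumes "c \<ge> 1"
  shows "ext.nu (stretched_filtration c) = - sqrt (real (M.dim UNIV))"
proof (cases "M.dim UNIV = 0")
  case False
  have "sqrt (real_of_int (c\<^sup>2 * int (M.dim UNIV))) = real_of_int c * sqrt (real (M.dim UNIV))"
    using assms by (simp add: real_sqrt_mult)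
  moreover have "real (M.dim UNIV) = sqrt (real (M.dim UNIV)) * sqrt (real (M.dim UNIV))" by simp
  ultimately show ?thesis
    using assms False
    by (simp add: ext.nu_def ext.filtration_norm_eq moments_stretched[OF assms] real_div_sqrt)
qed (simp add: ext.nu_def moments_stretched[OF assms])

lemma nu_ge:
  assumes "A.semiprime" and F: "ext.filtration F"
  shows "- sqrt (real (M.dim UNIV)) \<le> ext.nu F"
proof (cases "ext.wt F > 0")
  case False
  then have "0 \<le> ext.nu F"
    using ext.second_moment_nonneg[OF F]
    by (simp add: ext.nu_def ext.filtration_norm_eq divide_le_0_iff)
  moreover have "- sqrt (real (M.dim UNIV)) \<le> 0" by simp
  ultimately show ?thesis by (rule order.trans[rotated])
next
  case True
  note le = wt_square_le_extension[OF assms True]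
  have "(ext.wt F)\<^sup>2 \<le> int (M.dim UNIV) * ext.second_moment F"
    using le(1,2) mult_left_mono[OF le(4), of "int (M.dim UNIV)"] by linarith
  then have "(real_of_int (ext.wt F))\<^sup>2 \<le> real (M.dim UNIV) * real_of_int (ext.second_moment F)"
    by (metis of_int_le_iff of_int_mult of_int_of_nat_eq of_int_power)
  then have "real_of_int (ext.wt F) \<le> sqrt (real (M.dim UNIV)) * ext.filtration_norm F"
    unfolding ext.filtration_norm_eq real_sqrt_mult[symmetric] by (rule real_le_rsqrt)
  moreover from this have "ext.filtration_norm F > 0"
    using True ext.second_moment_nonneg[OF F]
    by (cases "ext.second_moment F = 0") (auto simp: ext.filtration_norm_eq)
  ultimately show ?thesis by (simp add: ext.nu_def pos_divide_le_eq)
qed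

lemma nu_minimal_stretched:
  assumes "A.semiprime" and F: "ext.filtration F" and d: "M.dim UNIV \<noteq> 0"
    and le: "ext.nu F \<le> - sqrt (real (M.dim UNIV))"
  shows "\<exists>c\<ge>1. F = stretched_filtration c"
proof (rule extremal_filtration_stretched[OF assms(1) F])
  have neg: "ext.nu F < 0" using le d by (smt (verit) of_nat_0_less_iff real_sqrt_gt_zero neq0_conv)
  have norm0: "ext.filtration_norm F \<ge> 0"
    using ext.second_moment_nonneg[OF F] by (simp add: ext.filtration_norm_eq)
  have norm: "ext.filtration_norm F > 0"
    using neg norm0 by (cases "ext.filtration_norm F = 0") (auto simp: ext.nu_def)
  show wt: "ext.wt F > 0"
    using neg norm by (simp add: ext.nu_def zero_less_divide_iff)
  have "sqrt (real (M.dim UNIV)) * ext.filtration_norm F \<le> real_of_int (ext.wt F)"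
    using le norm by (simp add: ext.nu_def pos_le_divide_eq)
  then have "(sqrt (real (M.dim UNIV)) * ext.filtration_norm F)\<^sup>2 \<le> (real_of_int (ext.wt F))\<^sup>2"
    using norm0 by (intro power_mono) auto
  then have "real (M.dim UNIV) * real_of_int (ext.second_moment F) \<le> (real_of_int (ext.wt F))\<^sup>2"
    using ext.second_moment_nonneg[OF F]
    by (simp add: power_mult_distrib ext.filtration_norm_eq)
  then show "int (M.dim UNIV) * ext.second_moment F \<le> (ext.wt F)\<^sup>2"
    by (metis of_int_le_iff of_int_mult of_int_of_nat_eq of_int_power)
qed

lemma canonical_filtration_nonzero:
  assumes "A.semiprime" and d: "M.dim UNIV \<noteq> 0"
  shows "ext.canonical_filtration F \<longleftrightarrow> (\<exists>c\<ge>1. F = stretched_filtration c)"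
proof -
  let ?E = "stretched_filtration :: int \<Rightarrow> int \<Rightarrow> ('a \<times> 'm) set"
  have wt: "ext.wt (?E c) > 0" if "c \<ge> 1" for c
    using that d by (simp add: moments_stretched)
  have triv: "ext.wt ext.trivial_filtration = 0"
  proof -
    have "ext.weights ext.trivial_filtration \<subseteq> {0}"
      by (auto simp: ext.weights_def ext.trivial_filtration_def split: if_splits)
    then show ?thesis unfolding ext.wt_def by (subst ext.sum_weights[of "{0}"]) auto
  qed
  have ntriv: "?E c \<noteq> ext.trivial_filtration" if "c \<ge> 1" for c
    using wt[OF that] triv by auto
  have "\<not> ext.semistable"
    unfolding ext.semistable_def using wt[of 1] filtration_stretched[of 1] by force
  then have can: "ext.canonical_filtration F \<longleftrightarrow> ext.filtration F \<and> F \<noteq> ext.trivial_filtration \<and>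
      (\<forall>G. ext.filtration G \<and> G \<noteq> ext.trivial_filtration \<longrightarrow> ext.nu F \<le> ext.nu G)"
    by (simp add: ext.canonical_filtration_def)
  show ?thesis
  proof
    assume "ext.canonical_filtration F"
    then have "ext.filtration F" "ext.nu F \<le> ext.nu (?E 1)"
      using can filtration_stretched[of 1] ntriv[of 1] by auto
    then show "\<exists>c\<ge>1. F = ?E c"
      using nu_minimal_stretched[OF assms(1) _ d] nu_stretched[of 1] by simp
  next
    assume "\<exists>c\<ge>1. F = ?E c"
    then show "ext.canonical_filtration F"
      unfolding can using filtration_stretched ntriv nu_stretched nu_ge[OF assms(1)] by auto
  qed
qed

lemma semistable_zero_module:
  assumes "A.semiprime" and d: "M.dim UNIV = 0"
  shows ext.semistable
proof -
  have "ext.wt F \<le> 0" if F: "ext.filtration F" for F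
  proof (rule ccontr)
    assume "\<not> ext.wt F \<le> 0"
    then show False using wt_square_le_extension(2,3)[OF assms(1) F] d by simp
  qed
  then show ?thesis by (simp add: ext.semistable_def)
qed

end

theorem proposition4p10:
  fixes scaleA :: "'k::field \<Rightarrow> 'a::ab_group_add \<Rightarrow> 'a"
    and multA :: "'a \<Rightarrow> 'a \<Rightarrow> 'a"
    and scaleM :: "'k \<Rightarrow> 'm::ab_group_add \<Rightarrow> 'm"
    and lact :: "'a \<Rightarrow> 'm \<Rightarrow> 'm"
    and ract :: "'m \<Rightarrow> 'a \<Rightarrow> 'm"
  assumes "perfect_field TYPE('k)"
    and "fd_algebra scaleA multA"
    and "fd_algebra.semisimple multA"
    and "fd_bimodule scaleA multA scaleM lact ract"
  shows "\<forall>F. fd_algebra.canonical_filtration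
               (module_prod.scale scaleA scaleM) (trivial_ext_mult multA lact ract) F
             \<longleftrightarrow> rescaling_equivalent F trivial_ext_filtration"
proof
  fix F :: "int \<Rightarrow> ('a \<times> 'm) set"
  interpret fd_bimodule scaleA multA scaleM lact ract by (rule assms(4))
  have semiprime: "A.semiprime" by (rule A.semisimple_imp_semiprime[OF assms(3)])
  have dim0: "M.dim UNIV = 0 \<longleftrightarrow> (UNIV :: 'm set) = {0}"
  proof
    assume "M.dim UNIV = 0"
    then show "(UNIV :: 'm set) = {0}"
      using M0.subspace_eqI_dim[OF M.subspace_single_0 M.subspace_UNIV] by simp
  next
    assume "(UNIV :: 'm set) = {0}"
    then show "M.dim UNIV = 0" using M0.dim_zero by (rule ssubst)
  qed
  show "ext.canonical_filtration F \<longleftrightarrow> rescaling_equivalent F trivial_ext_filtration"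
  proof (cases "M.dim UNIV = 0")
    case True
    then have "ext.canonical_filtration F \<longleftrightarrow> F = ext.trivial_filtration"
      using semistable_zero_module[OF semiprime] by (simp add: ext.canonical_filtration_def)
    also have triv: "ext.trivial_filtration = trivial_ext_filtration"
      using True dim0
      by (auto simp: fun_eq_iff ext.trivial_filtration_def trivial_ext_filtration_def Pair_eq_0_iff)
    also have "F = trivial_ext_filtration \<longleftrightarrow> rescaling_equivalent F trivial_ext_filtration"
    proof (rule rescaling_equivalent_const_iff[symmetric])
      show "rescale c trivial_ext_filtration n = (trivial_ext_filtration n :: ('a \<times> 'm) set)"
        if "c > 0" for c n
        using ceiling_divide_le_iff[OF that, of n 0]
        by (simp add: rescale_def triv[symmetric] ext.trivial_filtration_def)
    qed
    finally show ?thesis .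
  next
    case False
    then show ?thesis
      using canonical_filtration_nonzero[OF semiprime False] dim0
        rescaling_equivalent_stretched_iff by auto
  qed
qed

end
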